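(* Let $G$ be a profinite group and $(A,B,C)$ a Tate product over $G$. Suppose given discrete $G$-modules $D,D'',E$ and a commutative diagram of discrete $G$-modules with exact rows $$\begin{array}{ccccccccc}0&\to&B&\to&D&\to&E&\to&0\\&&\downarrow{\scriptstyle j}&&\downarrow&&\|&&\\0&\to&B''&\xrightarrow{\phi}&D''&\xrightarrow{\psi}&E&\to&0\end{array}$$ in which $j:B\to B''$ is the surjection of the Tate product, $D\to D''$ is surjective, and the right vertical map is the identity of $E$. Let $r\ge0$ and $s\ge1$ be integers. Then: (1) The restriction of the augmented cup product $$\cup_{\mathrm{aug}}:\operatorname{Im}\bigl(H^r(G,A)\xrightarrow{j_*}H^r(G,A'')\bigr)\times\operatorname{Ker}\bigl(H^s(G,B'')\xrightarrow{\phi_*}H^s(G,D'')\bigr)\to H^{r+s+1}(G,C)$$ is trivial (identically zero). (2) The augmented cup product induces a well-defined bilinear map $$\operatorname{Im}\bigl(H^r(G,A)\xrightarrow{j_*}H^r(G,A'')\bigr)\times\operatorname{Im}\bigl(H^s(G,B'')\xrightarrow{\phi_*}H^s(G,D'')\bigr)\to H^{r+s+1}(G,C),\quad(\alpha'',\phi_*\beta'')\mapsto\alpha''\cup_{\mathrm{aug}}\beta''.$$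
   Context: For a discrete $G$-module $A$, $C^r(G,A)$ is the group of continuous maps $G^r\to A$, with coboundary $d_rf(x_1,\ldots,x_{r+1})=x_1 f(x_2,\ldots,x_{r+1})+\sum_{i=1}^r(-1)^i f(x_1,\ldots,x_ix_{i+1},\ldots,x_{r+1})+(-1)^{r+1}f(x_1,\ldots,x_r)$; $Z^r=\ker d_r$, $B^r=\operatorname{im} d_{r-1}$, $H^r=Z^r/B^r$. A map $A\times B\to C$, $(a,b)\mapsto a\times b$, of discrete $G$-modules is $G$-bilinear if it is bilinear and $g(a\times b)=ga\times gb$. It induces the cup product $\cup:C^r(G,A)\times C^s(G,B)\to C^{r+s}(G,C)$, $(f\cup g)(x_1,\ldots,x_{r+s})=f(x_1,\ldots,x_r)\times x_1\cdots x_r\, g(x_{r+1},\ldots,x_{r+s})$. A Tate product $(A,B,C)$ over $G$ consists of two short exact sequences of discrete $G$-modules $0\to A'\xrightarrow{i}A\xrightarrow{j}A''\to0$ and $0\to B'\xrightarrow{i}B\xrightarrow{j}B''\to0$, a discrete $G$-module $C$, and two $G$-bilinear maps $A'\times B\to C$ and $A\times B'\to C$ that coincide on $A'\times B'$. One identifies $C^r(G,A')$ with $\ker(j_*:C^r(G,A)\to C^r(G,A''))$, and similarly for $B'$. Augmented cup product $\cup_{\mathrm{aug}}:H^r(G,A'')\times H^s(G,B'')\to H^{r+s+1}(G,C)$: given $\alpha'',\beta''$, choose $f\in C^r(G,A)$, $g\in C^s(G,B)$ with $j_*f,j_*g$ cocycles representing $\alpha'',\beta''$; then $d_rf\in C^{r+1}(G,A')$,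 $d_sg\in C^{s+1}(G,B')$, and $\alpha''\cup_{\mathrm{aug}}\beta''=[d_rf\cup g+(-1)^rf\cup d_sg]$ (well defined and bilinear). *)

theory Defs
  imports "HOL-Algebra.Coset" "HOL-Algebra.FiniteProduct" "HOL-Analysis.Analysis"
begin

section \<open>Profinite groups and discrete modules\<close>

record 'g tgroup = "'g monoid" +
  gtop :: "'g topology"

locale profinite_group = group G for G :: "'g tgroup" (structure) +
  assumes topspace_gtop: "topspace (gtop G) = carrier G"
    and continuous_mult: "continuous_map (prod_topology (gtop G) (gtop G)) (gtop G) (\<lambda>(x, y). x \<otimes> y)"
    and continuous_inv: "continuous_map (gtop G) (gtop G) (\<lambda>x. inv x)"
    and compact: "compact_space (gtop G)"
    and Hausdorff: "Hausdorff_space (gtop G)"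
    and totally_disconnected: "\<forall>x\<in>carrier G. connected_component_of_set (gtop G) x = {x}"

text \<open>The group underlying a module is a commutative group in the sense of HOL-Algebra, which is
  written multiplicatively: \<open>\<otimes>\<close> is the addition of the module, \<open>\<one>\<close> its zero element, and
  \<open>a [^] (n::int)\<close> the multiple of \<open>a\<close> by \<open>n\<close>.\<close>

record ('g, 'a) gmodule = "'a monoid" +
  act :: "'g \<Rightarrow> 'a \<Rightarrow> 'a"

locale discrete_gmodule = A: comm_group A
  for G :: "'g tgroup" and A :: "('g, 'a) gmodule" +
  assumes act_closed: "\<lbrakk>g \<in> carrier G; a \<in> carrier A\<rbrakk> \<Longrightarrow> act A g a \<in> carrier A"
    and act_add: "\<lbrakk>g \<in> carrier G; a \<in> carrier A; b \<in> carrier A\<rbrakk> \<Longrightarrow>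
      act A g (a \<otimes>\<^bsub>A\<^esub> b) = act A g a \<otimes>\<^bsub>A\<^esub> act A g b"
    and act_one: "a \<in> carrier A \<Longrightarrow> act A \<one>\<^bsub>G\<^esub> a = a"
    and act_mult: "\<lbrakk>g \<in> carrier G; h \<in> carrier G; a \<in> carrier A\<rbrakk> \<Longrightarrow>
      act A (g \<otimes>\<^bsub>G\<^esub> h) a = act A g (act A h a)"
    and act_continuous: "continuous_map (prod_topology (gtop G) (discrete_topology (carrier A)))
      (discrete_topology (carrier A)) (\<lambda>(g, a). act A g a)"

definition gmod_hom :: "'g tgroup \<Rightarrow> ('g, 'a) gmodule \<Rightarrow> ('g, 'b) gmodule \<Rightarrow> ('a \<Rightarrow> 'b) set" where
  "gmod_hom G A B =
    {h \<in> hom A B. \<forall>g\<in>carrier G. \<forall>a\<in>carrier A. h (act A g a) = act B g (h a)}"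

definition short_exact ::
  "'g tgroup \<Rightarrow> ('g, 'a) gmodule \<Rightarrow> ('a \<Rightarrow> 'b) \<Rightarrow> ('g, 'b) gmodule \<Rightarrow> ('b \<Rightarrow> 'c) \<Rightarrow> ('g, 'c) gmodule \<Rightarrow> bool"
  where
  "short_exact G A i B j C \<longleftrightarrow>
    discrete_gmodule G A \<and> discrete_gmodule G B \<and> discrete_gmodule G C \<and>
    i \<in> gmod_hom G A B \<and> j \<in> gmod_hom G B C \<and>
    inj_on i (carrier A) \<and> i ` carrier A = kernel B C j \<and> j ` carrier B = carrier C"

definition bilinear_pairing ::
  "('a, 'm) monoid_scheme \<Rightarrow> ('b, 'n) monoid_scheme \<Rightarrow> ('c, 'k) monoid_scheme \<Rightarrow> ('a \<Rightarrow> 'b \<Rightarrow> 'c) \<Rightarrow> bool"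
  where
  "bilinear_pairing A B C p \<longleftrightarrow>
    (\<forall>a\<in>carrier A. p a \<in> hom B C) \<and> (\<forall>b\<in>carrier B. (\<lambda>a. p a b) \<in> hom A C)"

definition G_bilinear ::
  "'g tgroup \<Rightarrow> ('g, 'a) gmodule \<Rightarrow> ('g, 'b) gmodule \<Rightarrow> ('g, 'c) gmodule \<Rightarrow> ('a \<Rightarrow> 'b \<Rightarrow> 'c) \<Rightarrow> bool"
  where
  "G_bilinear G A B C p \<longleftrightarrow> bilinear_pairing A B C p \<and>
    (\<forall>g\<in>carrier G. \<forall>a\<in>carrier A. \<forall>b\<in>carrier B. act C g (p a b) = p (act A g a) (act B g b))"

section \<open>Continuous cochains and cohomology\<close>

text \<open>Points of \<open>G\<^sup>r\<close> are extensional functions on \<open>{1..r}\<close>, and cochains are extensional on the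
  set of these points.\<close>

definition tuples_top :: "'g tgroup \<Rightarrow> nat \<Rightarrow> (nat \<Rightarrow> 'g) topology" where
  "tuples_top G r = product_topology (\<lambda>_. gtop G) {1..r}"

abbreviation tuples :: "'g tgroup \<Rightarrow> nat \<Rightarrow> (nat \<Rightarrow> 'g) set" where
  "tuples G r \<equiv> topspace (tuples_top G r)"

definition cochains :: "'g tgroup \<Rightarrow> ('g, 'a) gmodule \<Rightarrow> nat \<Rightarrow> ((nat \<Rightarrow> 'g) \<Rightarrow> 'a) monoid" where
  "cochains G A r =
    \<lparr>carrier = {f \<in> extensional (tuples G r).
        continuous_map (tuples_top G r) (discrete_topology (carrier A)) f},
     monoid.mult = (\<lambda>f g. \<lambda>x\<in>tuples G r. f x \<otimes>\<^bsub>A\<^esub> g x),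
     monoid.one = (\<lambda>x\<in>tuples G r. \<one>\<^bsub>A\<^esub>)\<rparr>"

text \<open>\<open>tuple_merge G r i (x\<^sub>1, \<dots>, x\<^sub>r\<^sub>+\<^sub>1) = (x\<^sub>1, \<dots>, x\<^sub>i x\<^sub>i\<^sub>+\<^sub>1, \<dots>, x\<^sub>r\<^sub>+\<^sub>1)\<close> and
  \<open>tuple_shift r s (x\<^sub>1, \<dots>, x\<^sub>r\<^sub>+\<^sub>s) = (x\<^sub>r\<^sub>+\<^sub>1, \<dots>, x\<^sub>r\<^sub>+\<^sub>s)\<close>\<close>

definition tuple_merge :: "'g tgroup \<Rightarrow> nat \<Rightarrow> nat \<Rightarrow> (nat \<Rightarrow> 'g) \<Rightarrow> nat \<Rightarrow> 'g" where
  "tuple_merge G r i x = (\<lambda>k\<in>{1..r}.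
    if k < i then x k else if k = i then x i \<otimes>\<^bsub>G\<^esub> x (i + 1) else x (k + 1))"

definition tuple_shift :: "nat \<Rightarrow> nat \<Rightarrow> (nat \<Rightarrow> 'g) \<Rightarrow> nat \<Rightarrow> 'g" where
  "tuple_shift r s x = (\<lambda>k\<in>{1..s}. x (r + k))"

definition coboundary ::
  "'g tgroup \<Rightarrow> ('g, 'a) gmodule \<Rightarrow> nat \<Rightarrow> ((nat \<Rightarrow> 'g) \<Rightarrow> 'a) \<Rightarrow> (nat \<Rightarrow> 'g) \<Rightarrow> 'a" where
  "coboundary G A r f = (\<lambda>x\<in>tuples G (r + 1).
     act A (x 1) (f (tuple_shift 1 r x)) \<otimes>\<^bsub>A\<^esub>
     (\<Otimes>\<^bsub>A\<^esub>i\<in>{1..r}. f (tuple_merge G r i x) [^]\<^bsub>A\<^esub> ((-1) ^ i :: int)) \<otimes>\<^bsub>A\<^esub>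
     f (restrict x {1..r}) [^]\<^bsub>A\<^esub> ((-1) ^ (r + 1) :: int))"

definition cocycles :: "'g tgroup \<Rightarrow> ('g, 'a) gmodule \<Rightarrow> nat \<Rightarrow> ((nat \<Rightarrow> 'g) \<Rightarrow> 'a) monoid" where
  "cocycles G A r = (cochains G A r)
    \<lparr>carrier := kernel (cochains G A r) (cochains G A (r + 1)) (coboundary G A r)\<rparr>"

fun coboundaries :: "'g tgroup \<Rightarrow> ('g, 'a) gmodule \<Rightarrow> nat \<Rightarrow> ((nat \<Rightarrow> 'g) \<Rightarrow> 'a) set" where
  "coboundaries G A 0 = {\<one>\<^bsub>cochains G A 0\<^esub>}"
| "coboundaries G A (Suc r) = coboundary G A r ` carrier (cochains G A r)"

definition cohomology :: "'g tgroup \<Rightarrow> ('g, 'a) gmodule \<Rightarrow> nat \<Rightarrow> ((nat \<Rightarrow> 'g) \<Rightarrow> 'a) set monoid" where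
  "cohomology G A r = cocycles G A r Mod coboundaries G A r"

definition coh_class ::
  "'g tgroup \<Rightarrow> ('g, 'a) gmodule \<Rightarrow> nat \<Rightarrow> ((nat \<Rightarrow> 'g) \<Rightarrow> 'a) \<Rightarrow> ((nat \<Rightarrow> 'g) \<Rightarrow> 'a) set" where
  "coh_class G A r f = coboundaries G A r #>\<^bsub>cocycles G A r\<^esub> f"

definition cochain_map ::
  "'g tgroup \<Rightarrow> nat \<Rightarrow> ('a \<Rightarrow> 'b) \<Rightarrow> ((nat \<Rightarrow> 'g) \<Rightarrow> 'a) \<Rightarrow> (nat \<Rightarrow> 'g) \<Rightarrow> 'b" where
  "cochain_map G r h f = (\<lambda>x\<in>tuples G r. h (f x))"

text \<open>The map \<open>H\<^sup>r(G, A) \<rightarrow> H\<^sup>r(G, B)\<close> induced by \<open>h : A \<rightarrow> B\<close>. A cohomology class is the set of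
  the cocycles that represent it, and all of these give the same class of \<open>B\<close>.\<close>

definition coh_map ::
  "'g tgroup \<Rightarrow> ('g, 'b) gmodule \<Rightarrow> nat \<Rightarrow> ('a \<Rightarrow> 'b) \<Rightarrow>
    ((nat \<Rightarrow> 'g) \<Rightarrow> 'a) set \<Rightarrow> ((nat \<Rightarrow> 'g) \<Rightarrow> 'b) set" where
  "coh_map G B r h \<alpha> = the_elem ((\<lambda>f. coh_class G B r (cochain_map G r h f)) ` \<alpha>)"

section \<open>Cup products\<close>

primrec tuple_prod :: "'g tgroup \<Rightarrow> nat \<Rightarrow> (nat \<Rightarrow> 'g) \<Rightarrow> 'g" where
  "tuple_prod G 0 x = \<one>\<^bsub>G\<^esub>"
| "tuple_prod G (Suc r) x = tuple_prod G r x \<otimes>\<^bsub>G\<^esub> x (Suc r)"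

definition cup ::
  "'g tgroup \<Rightarrow> ('g, 'b) gmodule \<Rightarrow> ('a \<Rightarrow> 'b \<Rightarrow> 'c) \<Rightarrow> nat \<Rightarrow> nat \<Rightarrow>
    ((nat \<Rightarrow> 'g) \<Rightarrow> 'a) \<Rightarrow> ((nat \<Rightarrow> 'g) \<Rightarrow> 'b) \<Rightarrow> (nat \<Rightarrow> 'g) \<Rightarrow> 'c" where
  "cup G B p r s f g = (\<lambda>x\<in>tuples G (r + s).
     p (f (restrict x {1..r})) (act B (tuple_prod G r x) (g (tuple_shift r s x))))"

text \<open>The pairings are \<open>p : A' \<times> B \<rightarrow> C\<close> and \<open>q : A \<times> B' \<rightarrow> C\<close>.\<close>

locale tate_product =
  fixes G :: "'g tgroup"
    and A' :: "('g, 'a1) gmodule" and iA :: "'a1 \<Rightarrow> 'a" and A :: "('g, 'a) gmodule"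
    and jA :: "'a \<Rightarrow> 'a2" and A'' :: "('g, 'a2) gmodule"
    and B' :: "('g, 'b1) gmodule" and iB :: "'b1 \<Rightarrow> 'b" and B :: "('g, 'b) gmodule"
    and jB :: "'b \<Rightarrow> 'b2" and B'' :: "('g, 'b2) gmodule"
    and C :: "('g, 'c) gmodule"
    and p :: "'a1 \<Rightarrow> 'b \<Rightarrow> 'c" and q :: "'a \<Rightarrow> 'b1 \<Rightarrow> 'c"
  assumes exact_A: "short_exact G A' iA A jA A''"
    and exact_B: "short_exact G B' iB B jB B''"
    and module_C: "discrete_gmodule G C"
    and bilinear_p: "G_bilinear G A' B C p"
    and bilinear_q: "G_bilinear G A B' C q"
    and coincide: "\<lbrakk>a \<in> carrier A'; b \<in> carrier B'\<rbrakk> \<Longrightarrow> p a (iB b) = q (iA a) b"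

text \<open>For an injection \<open>i : A' \<rightarrow> A\<close> this is the inverse of the identification of \<open>C\<^sup>r(G, A')\<close> with
  its image in \<open>C\<^sup>r(G, A)\<close>.\<close>

definition cochain_pullback ::
  "'g tgroup \<Rightarrow> ('g, 'a1) gmodule \<Rightarrow> nat \<Rightarrow> ('a1 \<Rightarrow> 'a) \<Rightarrow> ((nat \<Rightarrow> 'g) \<Rightarrow> 'a) \<Rightarrow> (nat \<Rightarrow> 'g) \<Rightarrow> 'a1" where
  "cochain_pullback G A' r i f = cochain_map G r (inv_into (carrier A') i) f"

definition aug_cup_cochain ::
  "'g tgroup \<Rightarrow> ('g, 'a1) gmodule \<Rightarrow> ('a1 \<Rightarrow> 'a) \<Rightarrow> ('g, 'a) gmodule \<Rightarrow>
    ('g, 'b1) gmodule \<Rightarrow> ('b1 \<Rightarrow> 'b) \<Rightarrow> ('g, 'b) gmodule \<Rightarrow>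
    ('g, 'c) gmodule \<Rightarrow> ('a1 \<Rightarrow> 'b \<Rightarrow> 'c) \<Rightarrow> ('a \<Rightarrow> 'b1 \<Rightarrow> 'c) \<Rightarrow> nat \<Rightarrow> nat \<Rightarrow>
    ((nat \<Rightarrow> 'g) \<Rightarrow> 'a) \<Rightarrow> ((nat \<Rightarrow> 'g) \<Rightarrow> 'b) \<Rightarrow> (nat \<Rightarrow> 'g) \<Rightarrow> 'c" where
  "aug_cup_cochain G A' iA A B' iB B C p q r s f g =
     cup G B p (r + 1) s (cochain_pullback G A' (r + 1) iA (coboundary G A r f)) g
     \<otimes>\<^bsub>cochains G C (r + s + 1)\<^esub>
     cup G B' q r (s + 1) f (cochain_pullback G B' (s + 1) iB (coboundary G B s g))
       [^]\<^bsub>cochains G C (r + s + 1)\<^esub> ((-1) ^ r :: int)"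

text \<open>The class does not depend on the choice of \<open>f\<close> and \<open>g\<close>. Membership of \<open>j\<^sub>* f\<close> in the coset
  \<open>\<alpha>\<close> says that \<open>j\<^sub>* f\<close> is a cocycle representing \<open>\<alpha>\<close>.\<close>

definition aug_cup ::
  "'g tgroup \<Rightarrow> ('g, 'a1) gmodule \<Rightarrow> ('a1 \<Rightarrow> 'a) \<Rightarrow> ('g, 'a) gmodule \<Rightarrow> ('a \<Rightarrow> 'a2) \<Rightarrow>
    ('g, 'b1) gmodule \<Rightarrow> ('b1 \<Rightarrow> 'b) \<Rightarrow> ('g, 'b) gmodule \<Rightarrow> ('b \<Rightarrow> 'b2) \<Rightarrow>
    ('g, 'c) gmodule \<Rightarrow> ('a1 \<Rightarrow> 'b \<Rightarrow> 'c) \<Rightarrow> ('a \<Rightarrow> 'b1 \<Rightarrow> 'c) \<Rightarrow> nat \<Rightarrow> nat \<Rightarrow>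
    ((nat \<Rightarrow> 'g) \<Rightarrow> 'a2) set \<Rightarrow> ((nat \<Rightarrow> 'g) \<Rightarrow> 'b2) set \<Rightarrow> ((nat \<Rightarrow> 'g) \<Rightarrow> 'c) set" where
  "aug_cup G A' iA A jA B' iB B jB C p q r s \<alpha> \<beta> =
     the_elem {coh_class G C (r + s + 1) (aug_cup_cochain G A' iA A B' iB B C p q r s f g) | f g.
       f \<in> carrier (cochains G A r) \<and> g \<in> carrier (cochains G B s) \<and>
       cochain_map G r jA f \<in> \<alpha> \<and> cochain_map G s jB g \<in> \<beta>}"

end

(*
  The coboundary is an alternating product of face maps. The cosimplicial identities give d d = 0, and
  splitting the alternating product for a cup product at position r gives the Leibniz rule.

  For cochains f, g whose images in A'', B'' are cocycles, the class of aug(f, g) = df u g + (-1)^r f u dg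
  is biadditive in (f, g). It vanishes if j f or j g is a coboundary: up to a coboundary, which can be
  lifted, f has values in A', and then aug(f, g) = d(f u g). Hence it may be computed with any lifts.

  In (1), the class from A is represented by a cocycle f of A. If phi b = d e'' and e lifts e'' to D, then
  d e has values in B and is a cocycle of B that lifts b. With cocycles as lifts on both sides aug is
  zero. By bilinearity, (2) follows from (1).
*)
theory Submission
  imports Defs
begin

text \<open>Formally the augmented cochain is the coboundary of the cup product of f and g, but A
  and B are not paired with each other, so this cup product does not exist. It does exist as soon as
  one factor takes values in the submodule, since then a single pairing serves both terms. The
  agreement of the two pairings on A' x B' is what makes this work, and it also makes the
  coboundaries of the two terms cancel. \<open>aug_cup\<close> is \<open>the_elem\<close> of the set
  of classes given by all lifts, so no value of it is known until that set is a singleton. This is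
  why the vanishing and additivity on cochains precede both claims. Lifting cochains meets no
  topological obstacle: modules are discrete, so composing a continuous cochain with a set-theoretic
  section gives a continuous cochain. The rows of the diagram share the quotient E, which forces the
  cocycle d e of D into B. The bound on s supplies a degree s - 1 in which e'' can live.\<close>

section \<open>Alternating products\<close>

text \<open>Modules are written multiplicatively, so this is the alternating sum of F 0, ..., F n.
  The recursion, in place of \<open>finprod\<close>, keeps the terms in order for induction and for
  splitting.\<close>

primrec alt_prod :: "('a, 'm) monoid_scheme \<Rightarrow> nat \<Rightarrow> (nat \<Rightarrow> 'a) \<Rightarrow> 'a" where
  "alt_prod A 0 F = F 0"
| "alt_prod A (Suc n) F = alt_prod A n F \<otimes>\<^bsub>A\<^esub> F (Suc n) [^]\<^bsub>A\<^esub> ((-1) ^ Suc n :: int)"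

lemma alt_prod_cong: "(\<And>i. i \<le> n \<Longrightarrow> F i = H i) \<Longrightarrow> alt_prod A n F = alt_prod A n H"
  by (induction n) auto

context comm_group
begin

lemma alt_prod_closed [simp, intro]:
  "(\<And>i. i \<le> n \<Longrightarrow> F i \<in> carrier G) \<Longrightarrow> alt_prod G n F \<in> carrier G"
  by (induction n) auto

lemma alt_prod_mult:
  assumes "\<And>i. i \<le> n \<Longrightarrow> F i \<in> carrier G" "\<And>i. i \<le> n \<Longrightarrow> H i \<in> carrier G"
  shows "alt_prod G n (\<lambda>i. F i \<otimes> H i) = alt_prod G n F \<otimes> alt_prod G n H"
  using assms
proof (induction n)
  case (Suc n)
  have [simp]: "F (Suc n) \<in> carrier G" "H (Suc n) \<in> carrier G"
    "alt_prod G n F \<in> carrier G" "alt_prod G n H \<in> carrier G"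
    using Suc.prems by auto
  have "alt_prod G n (\<lambda>i. F i \<otimes> H i) = alt_prod G n F \<otimes> alt_prod G n H"
    using Suc by auto
  then show ?case
    by (simp only: alt_prod.simps int_pow_distrib \<open>F (Suc n) \<in> carrier G\<close> \<open>H (Suc n) \<in> carrier G\<close>)
      (simp add: m_ac del: power_Suc)
qed simp

lemma alt_prod_pow:
  assumes "\<And>i. i \<le> n \<Longrightarrow> F i \<in> carrier G"
  shows "alt_prod G n (\<lambda>i. F i [^] (k::int)) = alt_prod G n F [^] k"
  using assms
proof (induction n)
  case (Suc n)
  have [simp]: "F (Suc n) \<in> carrier G" "alt_prod G n F \<in> carrier G"
    using Suc.prems by auto
  have "alt_prod G n (\<lambda>i. F i [^] k) = alt_prod G n F [^] k"
    using Suc by auto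
  then show ?case
    by (simp add: int_pow_distrib int_pow_pow mult.commute del: power_Suc)
qed simp

lemma alt_prod_hom:
  assumes "h \<in> hom G H" "group H" "\<And>i. i \<le> n \<Longrightarrow> F i \<in> carrier G"
  shows "h (alt_prod G n F) = alt_prod H n (\<lambda>i. h (F i))"
  using assms(3)
proof (induction n)
  case (Suc n)
  have [simp]: "F (Suc n) \<in> carrier G" "alt_prod G n F \<in> carrier G"
    using Suc.prems by auto
  show ?case
    using Suc by (simp add: hom_mult[OF assms(1)] hom_int_pow[OF assms(1)] assms(2) is_group del: power_Suc)
qed simp

text \<open>The tail is reindexed to start at 0, so it needs the sign of its first term. This split
  is behind the sign in the Leibniz rule.\<close>

lemma alt_prod_append:
  assumes "\<And>i. i \<le> Suc (n + m) \<Longrightarrow> F i \<in> carrier G"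
  shows "alt_prod G (Suc (n + m)) F =
    alt_prod G n F \<otimes> alt_prod G m (\<lambda>j. F (Suc (n + j))) [^] ((-1) ^ Suc n :: int)"
  using assms
proof (induction m)
  case (Suc m)
  have [simp]: "F (Suc (Suc (n + m))) \<in> carrier G" "alt_prod G n F \<in> carrier G"
    "alt_prod G m (\<lambda>j. F (Suc (n + j))) \<in> carrier G"
    using Suc.prems by auto
  have e: "(-1) ^ Suc (Suc (n + m)) = ((-1) ^ Suc m * (-1) ^ Suc n :: int)"
    by (simp add: power_add)
  have IH: "alt_prod G (Suc (n + m)) F =
      alt_prod G n F \<otimes> alt_prod G m (\<lambda>j. F (Suc (n + j))) [^] ((-1) ^ Suc n :: int)"
    using Suc by auto
  have "alt_prod G (Suc (n + Suc m)) F =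
      alt_prod G (Suc (n + m)) F \<otimes> F (Suc (Suc (n + m))) [^] ((-1) ^ Suc m * (-1) ^ Suc n :: int)"
    unfolding e[symmetric] by simp
  then show ?case
    unfolding IH by (simp add: int_pow_distrib int_pow_pow m_assoc del: power_Suc)
qed simp

lemma alt_prod_Suc_shift:
  assumes "\<And>i. i \<le> Suc n \<Longrightarrow> F i \<in> carrier G"
  shows "alt_prod G (Suc n) F = F 0 \<otimes> inv (alt_prod G n (\<lambda>i. F (Suc i)))"
  using alt_prod_append[of 0 n F] assms by (simp add: int_pow_neg)

text \<open>The combinatorial core of d d = 0: \<open>S j i\<close> and its partner
  \<open>S i (j - 1)\<close> carry opposite signs. The induction strips the last row and the last
  column of the array; by the symmetry they have the same entries, and a smaller array of the same
  kind remains.\<close>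

lemma alt_prod_double:
  assumes "\<And>i j. \<lbrakk>j \<le> Suc n; i \<le> n\<rbrakk> \<Longrightarrow> S j i \<in> carrier G"
    and "\<And>i j. \<lbrakk>i < j; j \<le> Suc n\<rbrakk> \<Longrightarrow> S j i = S i (j - 1)"
  shows "alt_prod G (Suc n) (\<lambda>j. alt_prod G n (S j)) = \<one>"
  using assms
proof (induction n)
  case 0
  have "S 1 0 = S 0 0" "S 0 0 \<in> carrier G" using 0 by auto
  then show ?case by (simp add: int_pow_neg)
next
  case (Suc n)
  \<comment> \<open>\<open>e\<close> is the sign of row \<open>n + 2\<close>, and \<open>- e\<close>
    that of column \<open>n + 1\<close>. \<open>X\<close> and \<open>y\<close> are the part of this
    column up to row \<open>n\<close> and its entry in row \<open>n + 1\<close>; the last row splits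
    into the same two pieces.\<close>
  define e :: int where "e = (-1) ^ n"
  define X where "X = alt_prod G n (\<lambda>i. S i (Suc n))"
  define y where "y = S (Suc n) (Suc n)"
  have cl: "j \<le> Suc (Suc n) \<Longrightarrow> i \<le> Suc n \<Longrightarrow> S j i \<in> carrier G" for i j
    using Suc.prems(1) by auto
  have [simp]: "X \<in> carrier G" "y \<in> carrier G"
    unfolding X_def y_def by (auto intro!: cl)
  have sw: "S (Suc (Suc n)) i = S i (Suc n)" if "i \<le> Suc n" for i
    using Suc.prems(2)[of i "Suc (Suc n)"] that by auto
  have last: "alt_prod G n (S (Suc (Suc n))) = X"
    unfolding X_def by (rule alt_prod_cong) (simp add: sw)
  have A: "alt_prod G (Suc n) (\<lambda>j. alt_prod G n (S j)) = \<one>"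
    using Suc.prems by (intro Suc.IH) auto
  have "alt_prod G (Suc (Suc n)) (\<lambda>j. alt_prod G (Suc n) (S j)) =
      alt_prod G (Suc n) (\<lambda>j. alt_prod G n (S j) \<otimes> S j (Suc n) [^] (- e)) \<otimes> (X \<otimes> y [^] (- e)) [^] e"
    using last sw[of "Suc n"] by (simp add: e_def y_def)
  also have "alt_prod G (Suc n) (\<lambda>j. alt_prod G n (S j) \<otimes> S j (Suc n) [^] (- e)) =
      alt_prod G (Suc n) (\<lambda>j. alt_prod G n (S j)) \<otimes> alt_prod G (Suc n) (\<lambda>j. S j (Suc n)) [^] (- e)"
    using cl by (subst alt_prod_mult) (auto simp: alt_prod_pow simp del: alt_prod.simps)
  also have "alt_prod G (Suc n) (\<lambda>j. S j (Suc n)) = X \<otimes> y [^] (- e)"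
    by (simp add: e_def X_def y_def)
  finally show ?case
    unfolding A by (simp add: int_pow_neg l_inv)
qed

text \<open>Bridge to \<open>coboundary\<close>, which keeps its term of index 0 outside the product
  over \<open>{1..r}\<close>.\<close>

lemma finprod_alt_prod:
  assumes "\<And>i. i \<le> n \<Longrightarrow> F i \<in> carrier G"
  shows "F 0 \<otimes> (\<Otimes>i\<in>{1..n}. F i [^] ((-1) ^ i :: int)) = alt_prod G n F"
  using assms
proof (induction n)
  case (Suc n)
  have [simp]: "F (Suc n) \<in> carrier G" "F 0 \<in> carrier G" using Suc.prems by auto
  have f: "(\<lambda>i. F i [^] ((-1) ^ i :: int)) \<in> {1..n} \<rightarrow> carrier G"
    using Suc.prems by (auto intro!: int_pow_closed)
  have "{1..Suc n} = insert (Suc n) {1..n}" by auto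
  then have "(\<Otimes>i\<in>{1..Suc n}. F i [^] ((-1) ^ i :: int)) =
      (\<Otimes>i\<in>{1..n}. F i [^] ((-1) ^ i :: int)) \<otimes> F (Suc n) [^] ((-1) ^ Suc n :: int)"
    using f by (simp add: m_comm del: power_Suc)
  then show ?case
    using Suc f by (simp add: m_assoc[symmetric] del: power_Suc)
qed simp

end

section \<open>The complex of continuous cochains\<close>

text \<open>A product of two discrete spaces is discrete and every map out of a discrete space is
  continuous, so \<open>p\<close> only has to land in \<open>U\<close>.\<close>

lemma continuous_map_discrete_op:
  assumes "continuous_map X (discrete_topology S) f" "continuous_map X (discrete_topology T) g"
    and "\<And>a b. \<lbrakk>a \<in> S; b \<in> T\<rbrakk> \<Longrightarrow> p a b \<in> U"
  shows "continuous_map X (discrete_topology U) (\<lambda>x. p (f x) (g x))"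
proof -
  have fg: "continuous_map X (discrete_topology (S \<times> T)) (\<lambda>x. (f x, g x))"
    using continuous_map_pairedI[OF assms(1,2)] by (simp add: prod_topology_discrete_topology)
  have "continuous_map (discrete_topology (S \<times> T)) (discrete_topology U) (\<lambda>(a, b). p a b)"
    using assms(3) by (auto simp: Pi_iff)
  from continuous_map_compose[OF fg this] show ?thesis
    by (simp add: o_def)
qed

lemma continuous_map_discrete_fun:
  assumes "continuous_map X (discrete_topology S) f" "\<And>a. a \<in> S \<Longrightarrow> h a \<in> U"
  shows "continuous_map X (discrete_topology U) (\<lambda>x. h (f x))"
  using continuous_map_discrete_op[OF assms(1,1), where p = "\<lambda>a b. h a" and U = U] assms(2) by blast

lemma cochains_iff:
  "f \<in> carrier (cochains G A r) \<longleftrightarrow> f \<in> extensional (tuples G r) \<and>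
    continuous_map (tuples_top G r) (discrete_topology (carrier A)) f"
  by (simp add: cochains_def)

lemma cochains_mult_apply:
  "x \<in> tuples G r \<Longrightarrow> (f \<otimes>\<^bsub>cochains G A r\<^esub> g) x = f x \<otimes>\<^bsub>A\<^esub> g x"
  by (simp add: cochains_def)

lemma cochains_one_apply:
  "x \<in> tuples G r \<Longrightarrow> \<one>\<^bsub>cochains G A r\<^esub> x = \<one>\<^bsub>A\<^esub>"
  by (simp add: cochains_def)

lemma cochain_closed:
  "\<lbrakk>f \<in> carrier (cochains G A r); x \<in> tuples G r\<rbrakk> \<Longrightarrow> f x \<in> carrier A"
  by (auto simp: cochains_iff dest!: continuous_map_image_subset_topspace)

lemma cochain_extensional: "f \<in> carrier (cochains G A r) \<Longrightarrow> f \<in> extensional (tuples G r)"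
  by (simp add: cochains_iff)

lemma cochain_continuous:
  "f \<in> carrier (cochains G A r) \<Longrightarrow> continuous_map (tuples_top G r) (discrete_topology (carrier A)) f"
  by (simp add: cochains_iff)

lemma restrict_cochain:
  assumes "continuous_map (tuples_top G r) (discrete_topology (carrier A)) f"
  shows "restrict f (tuples G r) \<in> carrier (cochains G A r)"
  using continuous_map_eq[OF assms, of "restrict f (tuples G r)"] by (simp add: cochains_iff)

lemma cochain_eqI:
  assumes "f \<in> carrier (cochains G A r)" "g \<in> carrier (cochains G A r)"
    and "\<And>x. x \<in> tuples G r \<Longrightarrow> f x = g x"
  shows "f = g"
  using assms cochain_extensional by (blast intro: extensionalityI)

section \<open>Continuity and closure of the operations on tuples\<close>

context profinite_group
begin

lemma tuples_eq: "tuples G r = PiE {1..r} (\<lambda>_. carrier G)"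
  by (simp add: tuples_top_def topspace_gtop)

lemma tuples_nth: "\<lbrakk>x \<in> tuples G r; 1 \<le> k; k \<le> r\<rbrakk> \<Longrightarrow> x k \<in> carrier G"
  by (auto simp: tuples_eq)

lemma continuous_map_tuples_nth:
  "\<lbrakk>1 \<le> k; k \<le> r\<rbrakk> \<Longrightarrow> continuous_map (tuples_top G r) (gtop G) (\<lambda>x. x k)"
  unfolding tuples_top_def by (rule continuous_map_product_projection) auto

lemma continuous_map_gtop_mult:
  assumes "continuous_map X (gtop G) u" "continuous_map X (gtop G) v"
  shows "continuous_map X (gtop G) (\<lambda>x. u x \<otimes> v x)"
  using continuous_map_compose[OF continuous_map_pairedI[OF assms] continuous_mult]
  by (simp add: o_def)

lemma continuous_map_tuple_merge:
  assumes "n = r + 1"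
  shows "continuous_map (tuples_top G n) (tuples_top G r) (tuple_merge G r i)"
  unfolding tuples_top_def[of G r] continuous_map_componentwise
proof (intro conjI ballI)
  fix k assume k: "k \<in> {1..r}"
  then have "continuous_map (tuples_top G n) (gtop G) (\<lambda>x. if k < i then x k
      else if k = i then x i \<otimes> x (i + 1) else x (k + 1))"
    using assms by (cases "k < i"; cases "k = i")
      (auto intro!: continuous_map_tuples_nth continuous_map_gtop_mult)
  then show "continuous_map (tuples_top G n) (gtop G) (\<lambda>x. tuple_merge G r i x k)"
    using k by (simp add: tuple_merge_def)
qed (auto simp: tuple_merge_def)

lemma continuous_map_tuple_shift:
  "n = r + s \<Longrightarrow> continuous_map (tuples_top G n) (tuples_top G s) (tuple_shift r s)"
  unfolding tuples_top_def[of G s] continuous_map_componentwise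
  by (auto simp: tuple_shift_def intro!: continuous_map_tuples_nth)

lemma continuous_map_tuple_restrict:
  "r \<le> n \<Longrightarrow> continuous_map (tuples_top G n) (tuples_top G r) (\<lambda>x. restrict x {1..r})"
  unfolding tuples_top_def[of G r] continuous_map_componentwise
  by (auto intro!: continuous_map_tuples_nth)

lemma continuous_map_tuple_prod:
  "r \<le> n \<Longrightarrow> continuous_map (tuples_top G n) (gtop G) (tuple_prod G r)"
proof (induction r)
  case 0
  have "continuous_map (tuples_top G n) (gtop G) (\<lambda>x. \<one>)"
    by (simp add: continuous_map_const topspace_gtop)
  then show ?case by simp
next
  case (Suc r)
  then have "continuous_map (tuples_top G n) (gtop G) (\<lambda>x. tuple_prod G r x \<otimes> x (Suc r))"
    by (intro continuous_map_gtop_mult continuous_map_tuples_nth) auto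
  then show ?case by simp
qed

lemma tuple_merge_closed:
  "x \<in> tuples G (r + 1) \<Longrightarrow> tuple_merge G r i x \<in> tuples G r"
  using continuous_map_image_subset_topspace[OF continuous_map_tuple_merge[OF refl, of r i]] by auto

lemma tuple_shift_closed:
  "x \<in> tuples G (r + s) \<Longrightarrow> tuple_shift r s x \<in> tuples G s"
  using continuous_map_image_subset_topspace[OF continuous_map_tuple_shift[OF refl, of r s]] by auto

lemma tuple_restrict_closed:
  "\<lbrakk>x \<in> tuples G n; r \<le> n\<rbrakk> \<Longrightarrow> restrict x {1..r} \<in> tuples G r"
  using continuous_map_image_subset_topspace[OF continuous_map_tuple_restrict[of r n]] by auto

lemma tuple_prod_closed:
  "\<lbrakk>x \<in> tuples G n; r \<le> n\<rbrakk> \<Longrightarrow> tuple_prod G r x \<in> carrier G"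
  using continuous_map_image_subset_topspace[OF continuous_map_tuple_prod[of r n]]
  by (auto simp: topspace_gtop)

end

section \<open>The group of continuous cochains\<close>

locale profinite_gmodule = profinite_group G + discrete_gmodule G A
  for G :: "'g tgroup" (structure) and A :: "('g, 'a) gmodule"
begin

lemma continuous_map_act:
  assumes "continuous_map X (gtop G) u" "continuous_map X (discrete_topology (carrier A)) f"
  shows "continuous_map X (discrete_topology (carrier A)) (\<lambda>x. act A (u x) (f x))"
  using continuous_map_compose[OF continuous_map_pairedI[OF assms] act_continuous]
  by (simp add: o_def)

lemma act_hom: "g \<in> carrier G \<Longrightarrow> act A g \<in> hom A A"
  by (auto simp: hom_def act_closed act_add)

lemma cochains_mult_closed:
  assumes "f \<in> carrier (cochains G A r)" "g \<in> carrier (cochains G A r)"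
  shows "f \<otimes>\<^bsub>cochains G A r\<^esub> g \<in> carrier (cochains G A r)"
proof -
  have "continuous_map (tuples_top G r) (discrete_topology (carrier A)) (\<lambda>x. f x \<otimes>\<^bsub>A\<^esub> g x)"
    using assms by (intro continuous_map_discrete_op[where p = "monoid.mult A"]) (auto simp: cochains_iff)
  from restrict_cochain[OF this] show ?thesis by (simp add: cochains_def)
qed

lemma cochains_one_closed: "\<one>\<^bsub>cochains G A r\<^esub> \<in> carrier (cochains G A r)"
proof -
  have "continuous_map (tuples_top G r) (discrete_topology (carrier A)) (\<lambda>x. \<one>\<^bsub>A\<^esub>)"
    by (simp add: continuous_map_const)
  from restrict_cochain[OF this] show ?thesis by (simp add: cochains_def)
qed

lemma comm_group_cochains: "comm_group (cochains G A r)"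
proof (rule comm_groupI)
  fix f assume f: "f \<in> carrier (cochains G A r)"
  have "continuous_map (tuples_top G r) (discrete_topology (carrier A)) (\<lambda>x. inv\<^bsub>A\<^esub> f x)"
    using f by (intro continuous_map_discrete_fun[where h = "m_inv A"]) (auto simp: cochains_iff)
  from restrict_cochain[OF this]
  have c: "restrict (\<lambda>x. inv\<^bsub>A\<^esub> f x) (tuples G r) \<in> carrier (cochains G A r)" (is "?g \<in> _") .
  have "?g \<otimes>\<^bsub>cochains G A r\<^esub> f = \<one>\<^bsub>cochains G A r\<^esub>"
    by (rule cochain_eqI[where A = A and G = G and r = r])
      (use f c cochain_closed[OF f] in \<open>auto simp: cochains_mult_apply cochains_one_apply
        cochains_mult_closed cochains_one_closed A.l_inv\<close>)
  with c show "\<exists>y\<in>carrier (cochains G A r). y \<otimes>\<^bsub>cochains G A r\<^esub> f = \<one>\<^bsub>cochains G A r\<^esub>"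
    by blast
next
  fix f assume f: "f \<in> carrier (cochains G A r)"
  show "\<one>\<^bsub>cochains G A r\<^esub> \<otimes>\<^bsub>cochains G A r\<^esub> f = f"
    by (rule cochain_eqI[where A = A and G = G and r = r])
      (use f cochain_closed[OF f] in \<open>auto simp: cochains_mult_apply cochains_one_apply
        cochains_mult_closed cochains_one_closed\<close>)
next
  fix f g h assume f: "f \<in> carrier (cochains G A r)" and g: "g \<in> carrier (cochains G A r)"
    and h: "h \<in> carrier (cochains G A r)"
  show "f \<otimes>\<^bsub>cochains G A r\<^esub> g \<otimes>\<^bsub>cochains G A r\<^esub> h = f \<otimes>\<^bsub>cochains G A r\<^esub> (g \<otimes>\<^bsub>cochains G A r\<^esub> h)"
    by (rule cochain_eqI[where A = A and G = G and r = r])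
      (use f g h cochain_closed[OF f] cochain_closed[OF g] cochain_closed[OF h] in
        \<open>auto simp: cochains_mult_apply cochains_mult_closed A.m_assoc\<close>)
  show "f \<otimes>\<^bsub>cochains G A r\<^esub> g = g \<otimes>\<^bsub>cochains G A r\<^esub> f"
    by (rule cochain_eqI[where A = A and G = G and r = r])
      (use f g cochain_closed[OF f] cochain_closed[OF g] in
        \<open>auto simp: cochains_mult_apply cochains_mult_closed A.m_comm\<close>)
qed (auto simp: cochains_mult_closed cochains_one_closed)

sublocale cochains: comm_group "cochains G A r" for r
  by (rule comm_group_cochains)

lemma cochain_eval_hom: "x \<in> tuples G r \<Longrightarrow> (\<lambda>f. f x) \<in> hom (cochains G A r) A"
  by (auto simp: hom_def cochain_closed cochains_mult_apply)

lemma cochains_int_pow_apply: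
  assumes "f \<in> carrier (cochains G A r)" "x \<in> tuples G r"
  shows "(f [^]\<^bsub>cochains G A r\<^esub> (k::int)) x = f x [^]\<^bsub>A\<^esub> k"
  using hom_int_pow[OF cochain_eval_hom[OF assms(2)] assms(1)] cochains.is_group A.is_group by simp

end

section \<open>Face maps and d d = 0\<close>

text \<open>The \<open>i\<close>-th term of the coboundary, without its sign. The merge with index \<open>0\<close> drops the first
  entry of a tuple and the merge with index \<open>r + 1\<close> drops the last one.\<close>

definition face :: "'g tgroup \<Rightarrow> ('g, 'a) gmodule \<Rightarrow> nat \<Rightarrow> nat \<Rightarrow> ((nat \<Rightarrow> 'g) \<Rightarrow> 'a) \<Rightarrow> (nat \<Rightarrow> 'g) \<Rightarrow> 'a" where
  "face G A r i f = (\<lambda>x\<in>tuples G (r + 1).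
     if i = 0 then act A (x 1) (f (tuple_merge G r 0 x)) else f (tuple_merge G r i x))"

lemma tuple_merge_last: "tuple_merge G r (Suc r) x = restrict x {1..r}"
  by (auto simp: tuple_merge_def restrict_def)

lemma tuple_merge_0: "tuple_merge G r 0 x = tuple_shift 1 r x"
  by (auto simp: tuple_merge_def tuple_shift_def restrict_def)

context profinite_gmodule
begin

lemma face_closed:
  assumes "f \<in> carrier (cochains G A r)"
  shows "face G A r i f \<in> carrier (cochains G A (r + 1))"
proof -
  have c: "continuous_map (tuples_top G (r + 1)) (discrete_topology (carrier A)) (\<lambda>x. f (tuple_merge G r i x))" for i
    using continuous_map_compose[OF continuous_map_tuple_merge[OF refl] cochain_continuous[OF assms]]
    by (simp add: o_def)
  have "continuous_map (tuples_top G (r + 1)) (discrete_topology (carrier A))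
     (\<lambda>x. if i = 0 then act A (x 1) (f (tuple_merge G r 0 x)) else f (tuple_merge G r i x))"
  proof (cases "i = 0")
    case True
    have "continuous_map (tuples_top G (r + 1)) (gtop G) (\<lambda>x. x 1)"
      by (rule continuous_map_tuples_nth) auto
    from continuous_map_act[OF this c[of 0]] show ?thesis using True by simp
  qed (use c in simp)
  from restrict_cochain[OF this] show ?thesis unfolding face_def .
qed

lemma face_apply_closed:
  "\<lbrakk>f \<in> carrier (cochains G A r); x \<in> tuples G (r + 1)\<rbrakk> \<Longrightarrow> face G A r i f x \<in> carrier A"
  using cochain_closed[OF face_closed] .

text \<open>Once the merges at 0 and \<open>r + 1\<close> are read as dropping an entry, all
  \<open>r + 2\<close> terms have one shape. The later computations with \<open>coboundary\<close>
  start from this form.\<close>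

lemma coboundary_apply:
  assumes "f \<in> carrier (cochains G A r)" "x \<in> tuples G (r + 1)"
  shows "coboundary G A r f x = alt_prod A (Suc r) (\<lambda>i. face G A r i f x)"
proof -
  have "(\<Otimes>\<^bsub>A\<^esub>i\<in>{1..r}. f (tuple_merge G r i x) [^]\<^bsub>A\<^esub> ((-1) ^ i :: int)) =
      (\<Otimes>\<^bsub>A\<^esub>i\<in>{1..r}. face G A r i f x [^]\<^bsub>A\<^esub> ((-1) ^ i :: int))"
    by (rule A.finprod_cong') (use assms face_apply_closed[OF assms] in \<open>auto simp: face_def\<close>)
  then have "act A (x 1) (f (tuple_shift 1 r x)) \<otimes>\<^bsub>A\<^esub>
      (\<Otimes>\<^bsub>A\<^esub>i\<in>{1..r}. f (tuple_merge G r i x) [^]\<^bsub>A\<^esub> ((-1) ^ i :: int)) = alt_prod A r (\<lambda>i. face G A r i f x)"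
    using A.finprod_alt_prod[of r "\<lambda>i. face G A r i f x"] face_apply_closed[OF assms] assms(2)
    by (simp add: face_def tuple_merge_0)
  then show ?thesis
    using assms(2) by (simp add: coboundary_def face_def tuple_merge_last del: power_Suc)
qed

lemma coboundary_closed:
  assumes "f \<in> carrier (cochains G A r)"
  shows "coboundary G A r f \<in> carrier (cochains G A (r + 1))"
proof -
  have "continuous_map (tuples_top G (r + 1)) (discrete_topology (carrier A)) (\<lambda>x. alt_prod A n (\<lambda>i. face G A r i f x))" for n
  proof (induction n)
    case (Suc n)
    have "continuous_map (tuples_top G (r + 1)) (discrete_topology (carrier A))
        (\<lambda>x. (\<lambda>a b. a \<otimes>\<^bsub>A\<^esub> b [^]\<^bsub>A\<^esub> ((-1) ^ Suc n :: int)) (alt_prod A n (\<lambda>i. face G A r i f x)) (face G A r (Suc n) f x))"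
      using Suc cochain_continuous[OF face_closed[OF assms, of "Suc n"]]
      by (rule continuous_map_discrete_op) auto
    then show ?case by simp
  qed (use cochain_continuous[OF face_closed[OF assms, of 0]] in simp)
  from restrict_cochain[OF this]
  have "restrict (\<lambda>x. alt_prod A (Suc r) (\<lambda>i. face G A r i f x)) (tuples G (r + 1)) \<in> carrier (cochains G A (r + 1))" .
  moreover have "coboundary G A r f = restrict (\<lambda>x. alt_prod A (Suc r) (\<lambda>i. face G A r i f x)) (tuples G (r + 1))"
    by (rule extensionalityI[where A = "tuples G (r + 1)"])
      (use coboundary_apply[OF assms] in \<open>auto simp: coboundary_def\<close>)
  ultimately show ?thesis by simp
qed

lemma face_mult:
  assumes "f \<in> carrier (cochains G A r)" "g \<in> carrier (cochains G A r)" "x \<in> tuples G (r + 1)"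
  shows "face G A r i (f \<otimes>\<^bsub>cochains G A r\<^esub> g) x = face G A r i f x \<otimes>\<^bsub>A\<^esub> face G A r i g x"
proof -
  have "tuple_merge G r i x \<in> tuples G r" for i
    by (rule tuple_merge_closed[OF assms(3)])
  then show ?thesis
    using assms cochain_closed[OF assms(1)] cochain_closed[OF assms(2)] tuples_nth[OF assms(3), of 1]
    by (auto simp: face_def cochains_mult_apply act_add)
qed

lemma coboundary_hom: "coboundary G A r \<in> hom (cochains G A r) (cochains G A (r + 1))"
proof (rule homI)
  fix f g assume f: "f \<in> carrier (cochains G A r)" and g: "g \<in> carrier (cochains G A r)"
  show "coboundary G A r (f \<otimes>\<^bsub>cochains G A r\<^esub> g) =
      coboundary G A r f \<otimes>\<^bsub>cochains G A (r + 1)\<^esub> coboundary G A r g"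
  proof (rule cochain_eqI[where A = A])
    fix x assume x: "x \<in> tuples G (r + 1)"
    show "coboundary G A r (f \<otimes>\<^bsub>cochains G A r\<^esub> g) x =
        (coboundary G A r f \<otimes>\<^bsub>cochains G A (r + 1)\<^esub> coboundary G A r g) x"
      using x f g face_apply_closed[OF f x] face_apply_closed[OF g x]
      by (simp add: cochains_mult_apply coboundary_apply face_mult A.alt_prod_mult del: alt_prod.simps)
  qed (use f g coboundary_closed in \<open>auto intro!: coboundary_closed cochains.m_closed\<close>)
qed (rule coboundary_closed)

text \<open>The cosimplicial identity on tuples. Only the position \<open>k = i\<close> with
  \<open>j = i + 1\<close> needs a group law, the associativity of three neighbouring entries. The
  end cases \<open>i = 0\<close> and \<open>j = r + 2\<close> are included because merging there
  drops an entry.\<close>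

lemma tuple_merge_merge:
  assumes "x \<in> tuples G (r + 2)" "i < j" "j \<le> Suc (Suc r)"
  shows "tuple_merge G r i (tuple_merge G (r + 1) j x) = tuple_merge G r (j - 1) (tuple_merge G (r + 1) i x)"
proof
  fix k
  have c: "x k \<in> carrier G" if "1 \<le> k" "k \<le> r + 2" for k
    using tuples_nth[OF assms(1)] that by auto
  show "tuple_merge G r i (tuple_merge G (r + 1) j x) k = tuple_merge G r (j - 1) (tuple_merge G (r + 1) i x) k"
  proof (cases "k \<in> {1..r}")
    case True
    then have k: "1 \<le> k" "k \<le> r" by auto
    consider "k < i" | "k = i" "j = k + 1" | "k = i" "j > k + 1" | "k > i" "k + 1 < j" | "k > i" "k + 1 = j" | "k + 1 > j"
      using assms by linarith
    then show ?thesis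
      by cases (use k assms c[of k] c[of "k+1"] c[of "k+2"] in \<open>auto simp: tuple_merge_def m_assoc\<close>)
  qed (auto simp: tuple_merge_def)
qed

text \<open>Beyond the identity on tuples only the action has to be watched. For
  \<open>i = 0\<close>, \<open>j = 1\<close> the claim is \<open>act_mult\<close>; for
  \<open>i = 0\<close> and larger \<open>j\<close> the entry that acts is untouched by the
  merge.\<close>

lemma face_face:
  assumes f: "f \<in> carrier (cochains G A r)" and x: "x \<in> tuples G (r + 2)" and "i < j" "j \<le> Suc (Suc r)"
  shows "face G A (r + 1) j (face G A r i f) x = face G A (r + 1) i (face G A r (j - 1) f) x"
proof -
  have x': "x \<in> tuples G (r + 1 + 1)" using x by simp
  have m: "tuple_merge G (r + 1) k x \<in> tuples G (r + 1)" for k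
    by (rule tuple_merge_closed[OF x'])
  have m2: "f (tuple_merge G r l (tuple_merge G (r + 1) k x)) \<in> carrier A" for k l
    by (rule cochain_closed[OF f tuple_merge_closed[OF m]])
  note mm = tuple_merge_merge[OF x assms(3,4)]
  have x12: "x (Suc 0) \<in> carrier G" "x 2 \<in> carrier G"
    using tuples_nth[OF x, of 1] tuples_nth[OF x, of 2] by auto
  consider "i = 0" "j = 1" | "i = 0" "j > 1" | "i > 0" "j > 1" using assms by linarith
  then show ?thesis
  proof cases
    case 1
    have "tuple_merge G (r + 1) 1 x 1 = x 1 \<otimes> x 2" "tuple_merge G (r + 1) 0 x 1 = x 2"
      by (auto simp: tuple_merge_def numeral_2_eq_2)
    then show ?thesis
      using 1 x' m mm m2[of 0 0] x12 by (simp add: face_def act_mult)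
  next
    case 2
    have "tuple_merge G (r + 1) j x 1 = x 1"
      using 2 by (auto simp: tuple_merge_def)
    then show ?thesis
      using 2 x' m mm by (simp add: face_def)
  next
    case 3
    then show ?thesis
      using x' m mm by (simp add: face_def)
  qed
qed

text \<open>\<open>alt_prod_double\<close> applied to the array of iterated faces at
  \<open>x\<close>, whose symmetry is \<open>face_face\<close>.\<close>

lemma coboundary_coboundary:
  assumes f: "f \<in> carrier (cochains G A r)"
  shows "coboundary G A (r + 1) (coboundary G A r f) = \<one>\<^bsub>cochains G A (r + 2)\<^esub>"
proof (rule cochain_eqI[where A = A])
  show "coboundary G A (r + 1) (coboundary G A r f) \<in> carrier (cochains G A (r + 2))"
    using coboundary_closed[OF coboundary_closed[OF f]] by simp
next
  fix x assume x: "x \<in> tuples G (r + 2)"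
  then have x': "x \<in> tuples G (r + 1 + 1)" by simp
  have m: "tuple_merge G (r + 1) k x \<in> tuples G (r + 1)" for k
    by (rule tuple_merge_closed[OF x'])
  have face_x: "face G A (r + 1) j h x = (if j = 0 then act A (x 1) (h (tuple_merge G (r + 1) 0 x))
      else h (tuple_merge G (r + 1) j x))" for j h
    using x' by (simp add: face_def)
  have "x 1 \<in> carrier G" using tuples_nth[OF x] by simp
  \<comment> \<open>Index 0 is the only face that changes values and not just arguments; there
    additivity of the action lets it pass through the inner alternating product.\<close>
  then have "act A (x 1) (alt_prod A (Suc r) (\<lambda>i. face G A r i f (tuple_merge G (r + 1) 0 x))) =
      alt_prod A (Suc r) (\<lambda>i. act A (x 1) (face G A r i f (tuple_merge G (r + 1) 0 x)))"
    by (intro A.alt_prod_hom act_hom A.is_group face_apply_closed[OF f m])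
  then have face_cob: "face G A (r + 1) j (coboundary G A r f) x =
      alt_prod A (Suc r) (\<lambda>i. face G A (r + 1) j (face G A r i f) x)" for j
    unfolding face_x coboundary_apply[OF f m] by (simp del: alt_prod.simps)
  have "coboundary G A (r + 1) (coboundary G A r f) x =
      alt_prod A (Suc (Suc r)) (\<lambda>j. alt_prod A (Suc r) (\<lambda>i. face G A (r + 1) j (face G A r i f) x))"
    using coboundary_apply[OF coboundary_closed[OF f] x'] face_cob by (simp del: alt_prod.simps)
  also have "\<dots> = \<one>\<^bsub>A\<^esub>"
    by (rule A.alt_prod_double)
      (use face_apply_closed[OF face_closed[OF f] x'] face_face[OF f x] in auto)
  finally show "coboundary G A (r + 1) (coboundary G A r f) x = \<one>\<^bsub>cochains G A (r + 2)\<^esub> x"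
    using x by (simp add: cochains_one_apply)
qed (rule cochains_one_closed)

end

section \<open>Functoriality and cup products\<close>

lemma cochain_map_apply: "x \<in> tuples G r \<Longrightarrow> cochain_map G r h f x = h (f x)"
  by (simp add: cochain_map_def)

lemma cochain_map_closed:
  assumes "\<And>a. a \<in> carrier A \<Longrightarrow> h a \<in> carrier B" "f \<in> carrier (cochains G A r)"
  shows "cochain_map G r h f \<in> carrier (cochains G B r)"
  unfolding cochain_map_def
  using continuous_map_discrete_fun[OF cochain_continuous[OF assms(2)], of h "carrier B"] assms(1)
  by (blast intro: restrict_cochain)

lemma gmod_hom_closed: "\<lbrakk>h \<in> gmod_hom G A B; a \<in> carrier A\<rbrakk> \<Longrightarrow> h a \<in> carrier B"
  by (auto simp: gmod_hom_def hom_def)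

text \<open>A set-theoretic section of \<open>h\<close> is a map between discrete spaces, so
  composing it with a cochain gives a cochain. Surjections of modules therefore stay surjective on
  cochains in every degree.\<close>

lemma cochain_map_lift:
  assumes "h ` carrier A = carrier B" "f \<in> carrier (cochains G B r)"
  obtains f' where "f' \<in> carrier (cochains G A r)" "cochain_map G r h f' = f"
proof
  show c: "cochain_map G r (inv_into (carrier A) h) f \<in> carrier (cochains G A r)"
    by (rule cochain_map_closed[OF _ assms(2)]) (use assms(1) in \<open>auto intro: inv_into_into\<close>)
  show "cochain_map G r h (cochain_map G r (inv_into (carrier A) h) f) = f"
  proof (rule cochain_eqI[where A = B])
    show "cochain_map G r h (cochain_map G r (inv_into (carrier A) h) f) \<in> carrier (cochains G B r)"
      by (rule cochain_map_closed[OF _ c]) (use assms(1) in auto)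
    fix x assume x: "x \<in> tuples G r"
    then have "f x \<in> h ` carrier A" using cochain_closed[OF assms(2)] assms(1) by simp
    with x show "cochain_map G r h (cochain_map G r (inv_into (carrier A) h) f) x = f x"
      by (simp add: cochain_map_apply f_inv_into_f)
  qed fact
qed

lemma cochain_map_cochain_map:
  assumes "f \<in> carrier (cochains G A r)" "\<And>a. a \<in> carrier A \<Longrightarrow> k (h a) = k' (h' a)"
  shows "cochain_map G r k (cochain_map G r h f) = cochain_map G r k' (cochain_map G r h' f)"
  using assms(2) cochain_closed[OF assms(1)] by (auto simp: cochain_map_def)

lemma short_exact_gmodules:
  assumes "profinite_group G" "short_exact G A i B j C"
  shows "profinite_gmodule G A" "profinite_gmodule G B" "profinite_gmodule G C"
  using assms by (auto simp: short_exact_def profinite_gmodule_def)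

locale profinite_gmod_hom = A: profinite_gmodule G A + B: profinite_gmodule G B
  for G :: "'g tgroup" (structure) and A :: "('g, 'a) gmodule" and B :: "('g, 'b) gmodule" +
  fixes h :: "'a \<Rightarrow> 'b"
  assumes gmod_hom: "h \<in> gmod_hom G A B"
begin

lemma map_hom: "h \<in> hom A B"
  using gmod_hom by (simp add: gmod_hom_def)

lemma map_act: "\<lbrakk>g \<in> carrier G; a \<in> carrier A\<rbrakk> \<Longrightarrow> h (act A g a) = act B g (h a)"
  using gmod_hom by (simp add: gmod_hom_def)

lemma map_closed: "a \<in> carrier A \<Longrightarrow> h a \<in> carrier B"
  using gmod_hom by (rule gmod_hom_closed)

lemma cochain_map_in_cochains:
  "f \<in> carrier (cochains G A r) \<Longrightarrow> cochain_map G r h f \<in> carrier (cochains G B r)"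
  by (rule cochain_map_closed[OF map_closed])

lemma cochain_map_hom: "cochain_map G r h \<in> hom (cochains G A r) (cochains G B r)"
proof (rule homI)
  fix f g assume f: "f \<in> carrier (cochains G A r)" and g: "g \<in> carrier (cochains G A r)"
  show "cochain_map G r h (f \<otimes>\<^bsub>cochains G A r\<^esub> g) =
      cochain_map G r h f \<otimes>\<^bsub>cochains G B r\<^esub> cochain_map G r h g"
    by (rule cochain_eqI[where A = B and G = G and r = r])
      (use f g cochain_closed[OF f] cochain_closed[OF g] in \<open>auto simp: cochain_map_apply
        cochains_mult_apply hom_mult[OF map_hom] intro!: cochain_map_in_cochains\<close>)
qed (rule cochain_map_in_cochains)

text \<open>Equivariance makes \<open>h\<close> commute with each face, additivity with their
  alternating product.\<close>

lemma coboundary_cochain_map: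
  assumes f: "f \<in> carrier (cochains G A r)"
  shows "coboundary G B r (cochain_map G r h f) = cochain_map G (r + 1) h (coboundary G A r f)"
proof (rule cochain_eqI[where A = B])
  fix x assume x: "x \<in> tuples G (r + 1)"
  have m: "tuple_merge G r i x \<in> tuples G r" for i
    by (rule A.tuple_merge_closed[OF x])
  have "x 1 \<in> carrier G" using A.tuples_nth[OF x] by simp
  then have "face G B r i (cochain_map G r h f) x = h (face G A r i f x)" for i
    using x m cochain_closed[OF f m] by (simp add: face_def cochain_map_apply map_act)
  then show "coboundary G B r (cochain_map G r h f) x = cochain_map G (r + 1) h (coboundary G A r f) x"
    using x A.coboundary_apply[OF f x] B.coboundary_apply[OF cochain_map_in_cochains[OF f] x]
      A.A.alt_prod_hom[OF map_hom B.A.is_group A.face_apply_closed[OF f x], of "Suc r" "\<lambda>i. i"]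
    by (simp add: cochain_map_apply del: alt_prod.simps)
qed (rule B.coboundary_closed[OF cochain_map_in_cochains[OF f]]
    cochain_map_in_cochains[OF A.coboundary_closed[OF f]])+

end

section \<open>Cup products and the Leibniz rule\<close>

lemma tuple_prod_cong: "(\<And>k. \<lbrakk>1 \<le> k; k \<le> r\<rbrakk> \<Longrightarrow> x k = y k) \<Longrightarrow> tuple_prod G r x = tuple_prod G r y"
  by (induction r) auto

context profinite_group
begin

text \<open>For face 0 of a cup product: the \<open>x 1\<close> by which it acts is absorbed into
  the product that acts on the second factor.\<close>

lemma tuple_prod_shift:
  "x \<in> tuples G n \<Longrightarrow> r < n \<Longrightarrow> r \<le> m \<Longrightarrow> x 1 \<otimes> tuple_prod G r (tuple_merge G m 0 x) = tuple_prod G (Suc r) x"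
proof (induction r)
  case 0
  then show ?case using tuples_nth[of x n 1] by simp
next
  case (Suc r)
  have cx: "x 1 \<in> carrier G" "x (Suc (Suc r)) \<in> carrier G"
    using Suc.prems tuples_nth[OF Suc.prems(1)] by auto
  have m: "tuple_merge G m 0 x (Suc r) = x (Suc (Suc r))"
    using Suc.prems by (simp add: tuple_merge_def)
  \<comment> \<open>\<open>n\<close> and \<open>m\<close> are independent, so
    \<open>tuple_merge G m 0 x\<close> need not be a tuple over \<open>G\<close> and
    \<open>tuple_prod_closed\<close> is out of reach; only its first \<open>r\<close> entries are
    known to lie in \<open>G\<close>.\<close>
  have t: "tuple_prod G r (tuple_merge G m 0 x) \<in> carrier G"
  proof -
    have "tuple_prod G k (tuple_merge G m 0 x) \<in> carrier G" if "k \<le> r" for k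
      using that
    proof (induction k)
      case (Suc k)
      have "x (Suc (Suc k)) \<in> carrier G"
        using Suc.prems \<open>Suc r < n\<close> tuples_nth[OF \<open>x \<in> tuples G n\<close>] by auto
      then show ?case using Suc \<open>Suc r \<le> m\<close> by (simp add: tuple_merge_def)
    qed simp
    then show ?thesis by blast
  qed
  have "x 1 \<otimes> tuple_prod G (Suc r) (tuple_merge G m 0 x) =
      (x 1 \<otimes> tuple_prod G r (tuple_merge G m 0 x)) \<otimes> x (Suc (Suc r))"
    using cx t by (simp add: m m_assoc)
  also have "\<dots> = tuple_prod G (Suc (Suc r)) x"
    using Suc by simp
  finally show ?case .
qed

text \<open>Associativity: two neighbours are multiplied in advance, so \<open>r\<close> merged
  entries account for \<open>r + 1\<close> original ones.\<close>

lemma tuple_prod_merge: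
  assumes "x \<in> tuples G n" "r < n" "r \<le> m" "1 \<le> i" "i \<le> r"
  shows "tuple_prod G r (tuple_merge G m i x) = tuple_prod G (Suc r) x"
  using assms
proof (induction r)
  case (Suc r)
  have c: "x (Suc r) \<in> carrier G" "x (Suc (Suc r)) \<in> carrier G" "tuple_prod G r x \<in> carrier G"
    using Suc.prems tuples_nth[OF Suc.prems(1)] tuple_prod_closed[OF Suc.prems(1), of r] by auto
  show ?case
  proof (cases "i = Suc r")
    case True
    have "tuple_prod G r (tuple_merge G m i x) = tuple_prod G r x"
      using True Suc.prems by (intro tuple_prod_cong) (auto simp: tuple_merge_def)
    moreover have "tuple_merge G m i x (Suc r) = x (Suc r) \<otimes> x (Suc (Suc r))"
      using True Suc.prems by (simp add: tuple_merge_def)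
    ultimately show ?thesis
      using c by (simp add: m_assoc)
  next
    case False
    then show ?thesis using Suc by (simp add: tuple_merge_def)
  qed
qed simp

end

text \<open>Instantiated twice for a Tate product, with \<open>p\<close> on A' x B and with
  \<open>q\<close> on A x B'.\<close>

locale cup_pairing = A: profinite_gmodule G A + B: profinite_gmodule G B + C: profinite_gmodule G C
  for G :: "'g tgroup" (structure)
    and A :: "('g, 'a) gmodule" and B :: "('g, 'b) gmodule" and C :: "('g, 'c) gmodule" +
  fixes p :: "'a \<Rightarrow> 'b \<Rightarrow> 'c"
  assumes G_bilinear: "G_bilinear G A B C p"
begin

lemma pairing_hom_right: "a \<in> carrier A \<Longrightarrow> p a \<in> hom B C"
  using G_bilinear by (simp add: G_bilinear_def bilinear_pairing_def)

lemma pairing_hom_left: "b \<in> carrier B \<Longrightarrow> (\<lambda>a. p a b) \<in> hom A C"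
  using G_bilinear by (simp add: G_bilinear_def bilinear_pairing_def)

lemma pairing_closed: "\<lbrakk>a \<in> carrier A; b \<in> carrier B\<rbrakk> \<Longrightarrow> p a b \<in> carrier C"
  using pairing_hom_right by (auto simp: hom_def)

lemma pairing_act:
  "\<lbrakk>g \<in> carrier G; a \<in> carrier A; b \<in> carrier B\<rbrakk> \<Longrightarrow> act C g (p a b) = p (act A g a) (act B g b)"
  using G_bilinear by (simp add: G_bilinear_def)

lemma cup_apply:
  "x \<in> tuples G (r + s) \<Longrightarrow> cup G B p r s f g x =
    p (f (restrict x {1..r})) (act B (tuple_prod G r x) (g (tuple_shift r s x)))"
  by (simp add: cup_def)

lemma cup_arguments_closed:
  assumes "x \<in> tuples G (r + s)"
  shows "f \<in> carrier (cochains G A r) \<Longrightarrow> f (restrict x {1..r}) \<in> carrier A"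
    and "g \<in> carrier (cochains G B s) \<Longrightarrow> g (tuple_shift r s x) \<in> carrier B"
    and "tuple_prod G r x \<in> carrier G"
    and "g \<in> carrier (cochains G B s) \<Longrightarrow> act B (tuple_prod G r x) (g (tuple_shift r s x)) \<in> carrier B"
proof -
  show "f \<in> carrier (cochains G A r) \<Longrightarrow> f (restrict x {1..r}) \<in> carrier A"
    using A.tuple_restrict_closed[OF assms, of r] by (simp add: cochain_closed)
  show g: "g \<in> carrier (cochains G B s) \<Longrightarrow> g (tuple_shift r s x) \<in> carrier B"
    using A.tuple_shift_closed[OF assms] by (simp add: cochain_closed)
  show t: "tuple_prod G r x \<in> carrier G"
    using A.tuple_prod_closed[OF assms, of r] by simp
  show "g \<in> carrier (cochains G B s) \<Longrightarrow> act B (tuple_prod G r x) (g (tuple_shift r s x)) \<in> carrier B"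
    using B.act_closed[OF t g] .
qed

lemma cup_closed:
  assumes "f \<in> carrier (cochains G A r)" "g \<in> carrier (cochains G B s)"
  shows "cup G B p r s f g \<in> carrier (cochains G C (r + s))"
proof -
  have "continuous_map (tuples_top G (r + s)) (discrete_topology (carrier A)) (\<lambda>x. f (restrict x {1..r}))"
    using continuous_map_compose[OF A.continuous_map_tuple_restrict cochain_continuous[OF assms(1)], of "r + s"]
    by (simp add: o_def)
  moreover have "continuous_map (tuples_top G (r + s)) (discrete_topology (carrier B)) (\<lambda>x. g (tuple_shift r s x))"
    using continuous_map_compose[OF A.continuous_map_tuple_shift[OF refl] cochain_continuous[OF assms(2)]]
    by (simp add: o_def)
  then have "continuous_map (tuples_top G (r + s)) (discrete_topology (carrier B))
      (\<lambda>x. act B (tuple_prod G r x) (g (tuple_shift r s x)))"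
    by (intro B.continuous_map_act A.continuous_map_tuple_prod) auto
  ultimately have "continuous_map (tuples_top G (r + s)) (discrete_topology (carrier C))
      (\<lambda>x. p (f (restrict x {1..r})) (act B (tuple_prod G r x) (g (tuple_shift r s x))))"
    by (rule continuous_map_discrete_op) (rule pairing_closed)
  then show ?thesis unfolding cup_def by (rule restrict_cochain)
qed

lemma cup_bilinear:
  "bilinear_pairing (cochains G A r) (cochains G B s) (cochains G C (r + s)) (cup G B p r s)"
  unfolding bilinear_pairing_def
proof (intro conjI ballI homI cup_closed)
  fix f g g' assume f: "f \<in> carrier (cochains G A r)"
    and g: "g \<in> carrier (cochains G B s)" and g': "g' \<in> carrier (cochains G B s)"
  show "cup G B p r s f (g \<otimes>\<^bsub>cochains G B s\<^esub> g') =
      cup G B p r s f g \<otimes>\<^bsub>cochains G C (r + s)\<^esub> cup G B p r s f g'"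
  proof (rule cochain_eqI[where A = C])
    fix x assume x: "x \<in> tuples G (r + s)"
    show "cup G B p r s f (g \<otimes>\<^bsub>cochains G B s\<^esub> g') x =
        (cup G B p r s f g \<otimes>\<^bsub>cochains G C (r + s)\<^esub> cup G B p r s f g') x"
      using x f g g' cup_arguments_closed[OF x] A.tuple_shift_closed[OF x]
      by (simp add: cup_apply cochains_mult_apply B.act_add hom_mult[OF pairing_hom_right])
  qed (use f g g' in \<open>auto intro!: cup_closed C.cochains.m_closed\<close>)
next
  fix g f f' assume g: "g \<in> carrier (cochains G B s)"
    and f: "f \<in> carrier (cochains G A r)" and f': "f' \<in> carrier (cochains G A r)"
  show "cup G B p r s (f \<otimes>\<^bsub>cochains G A r\<^esub> f') g =
      cup G B p r s f g \<otimes>\<^bsub>cochains G C (r + s)\<^esub> cup G B p r s f' g"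
  proof (rule cochain_eqI[where A = C])
    fix x assume x: "x \<in> tuples G (r + s)"
    show "cup G B p r s (f \<otimes>\<^bsub>cochains G A r\<^esub> f') g x =
        (cup G B p r s f g \<otimes>\<^bsub>cochains G C (r + s)\<^esub> cup G B p r s f' g) x"
      using x f g f' cup_arguments_closed[OF x] A.tuple_restrict_closed[OF x, of r]
      by (simp add: cup_apply cochains_mult_apply hom_mult[OF pairing_hom_left])
  qed (use f g f' in \<open>auto intro!: cup_closed C.cochains.m_closed\<close>)
qed

lemmas cup_hom_right = cup_bilinear[unfolded bilinear_pairing_def, THEN conjunct1, rule_format]
lemmas cup_hom_left = cup_bilinear[unfolded bilinear_pairing_def, THEN conjunct2, rule_format]

text \<open>For \<open>0 < i\<close> the merge falls among the arguments of \<open>f\<close>, and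
  the product acting on \<open>g\<close> is unchanged. For \<open>i = 0\<close> equivariance of the
  pairing distributes \<open>x 1\<close> over both factors, where it completes the shifted product
  to that of the first \<open>r + 1\<close> entries.\<close>

lemma face_cup_left:
  assumes "f \<in> carrier (cochains G A r)" "g \<in> carrier (cochains G B s)"
    and x: "x \<in> tuples G (r + s + 1)" and "i \<le> r"
  shows "face G C (r + s) i (cup G B p r s f g) x = cup G B p (r + 1) s (face G A r i f) g x"
proof -
  have x': "x \<in> tuples G (r + 1 + s)" using x by (simp add: ac_simps)
  have m: "tuple_merge G (r + s) i x \<in> tuples G (r + s)"
    by (rule A.tuple_merge_closed[OF x])
  have rx: "restrict x {1..r+1} \<in> tuples G (r + 1)"
    by (rule A.tuple_restrict_closed[OF x']) simp
  have e1: "restrict (tuple_merge G (r + s) i x) {1..r} = tuple_merge G r i (restrict x {1..r+1})"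
    using assms(4) by (auto simp: tuple_merge_def restrict_def)
  have e2: "tuple_shift r s (tuple_merge G (r + s) i x) = tuple_shift (r + 1) s x"
    using assms(4) by (auto simp: tuple_merge_def tuple_shift_def restrict_def)
  note cl = cup_arguments_closed[OF m] and ff = assms(1,2)
  show ?thesis
  proof (cases "i = 0")
    case True
    have x1: "x 1 \<in> carrier G" using A.tuples_nth[OF x] by simp
    have "act B (x 1) (act B (tuple_prod G r (tuple_merge G (r + s) i x)) (g (tuple_shift (r + 1) s x))) =
        act B (tuple_prod G (r + 1) x) (g (tuple_shift (r + 1) s x))"
      using True A.tuple_prod_shift[OF x, of r "r + s"] B.act_mult[OF x1 cl(3) cl(2)[OF ff(2)]] e2 by simp
    then show ?thesis
      using True x x' m rx pairing_act[OF x1 cl(1)[OF ff(1)] cl(4)[OF ff(2)]] e1 e2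
      by (simp add: face_def cup_apply)
  next
    case False
    then have "tuple_prod G r (tuple_merge G (r + s) i x) = tuple_prod G (r + 1) x"
      using A.tuple_prod_merge[OF x, of r "r + s" i] assms(4) by simp
    then show ?thesis
      using False x x' m rx e1 e2 by (simp add: face_def cup_apply)
  qed
qed

text \<open>Merges past position \<open>r\<close> fall among the arguments of \<open>g\<close>. The
  index \<open>Suc j\<close> skips face 0 of \<open>g\<close>, which is not a face of the cup
  product.\<close>

lemma face_cup_right:
  assumes "f \<in> carrier (cochains G A r)" "g \<in> carrier (cochains G B s)"
    and x: "x \<in> tuples G (r + s + 1)"
  shows "face G C (r + s) (Suc (r + j)) (cup G B p r s f g) x = cup G B p r (s + 1) f (face G B s (Suc j) g) x"
proof -
  have x': "x \<in> tuples G (r + (s + 1))" using x by (simp add: ac_simps)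
  have m: "tuple_merge G (r + s) (Suc (r + j)) x \<in> tuples G (r + s)"
    by (rule A.tuple_merge_closed[OF x])
  have sx: "tuple_shift r (s + 1) x \<in> tuples G (s + 1)"
    by (rule A.tuple_shift_closed[OF x'])
  have e1: "restrict (tuple_merge G (r + s) (Suc (r + j)) x) {1..r} = restrict x {1..r}"
    by (auto simp: tuple_merge_def restrict_def)
  have e2: "tuple_shift r s (tuple_merge G (r + s) (Suc (r + j)) x) = tuple_merge G s (Suc j) (tuple_shift r (s + 1) x)"
    by (auto simp: tuple_merge_def tuple_shift_def restrict_def)
  have e3: "tuple_prod G r (tuple_merge G (r + s) (Suc (r + j)) x) = tuple_prod G r x"
    by (intro tuple_prod_cong) (auto simp: tuple_merge_def)
  show ?thesis
    using x x' m sx e1 e2 e3 by (simp add: face_def cup_apply)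
qed

text \<open>The last face of \<open>f\<close> and face 0 of \<open>g\<close> give the two Leibniz
  terms that are absent from the coboundary of the cup product. In both, \<open>x (r + 1)\<close> is
  no argument any more but acts on \<open>g\<close>. They carry opposite signs and cancel.\<close>

lemma face_cup_middle:
  assumes "f \<in> carrier (cochains G A r)" "g \<in> carrier (cochains G B s)"
    and x: "x \<in> tuples G (r + s + 1)"
  shows "cup G B p (r + 1) s (face G A r (Suc r) f) g x = cup G B p r (s + 1) f (face G B s 0 g) x"
proof -
  have x': "x \<in> tuples G (r + 1 + s)" "x \<in> tuples G (r + (s + 1))" using x by (simp_all add: ac_simps)
  have sx: "tuple_shift r (s + 1) x \<in> tuples G (s + 1)"
    by (rule A.tuple_shift_closed[OF x'(2)])
  have rx: "restrict x {1..r+1} \<in> tuples G (r + 1)"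
    by (rule A.tuple_restrict_closed[OF x'(1)]) simp
  have e1: "restrict (restrict x {1..r+1}) {1..r} = restrict x {1..r}"
    by (auto simp: restrict_def)
  have e2: "tuple_merge G s 0 (tuple_shift r (s + 1) x) = tuple_shift (r + 1) s x"
    by (auto simp: tuple_merge_def tuple_shift_def restrict_def)
  have e3: "tuple_shift r (s + 1) x 1 = x (Suc r)"
    by (simp add: tuple_shift_def)
  have "x (Suc r) \<in> carrier G" using A.tuples_nth[OF x] by simp
  moreover have "tuple_prod G r x \<in> carrier G"
    using A.tuple_prod_closed[OF x] by simp
  ultimately have "act B (tuple_prod G (r + 1) x) (g (tuple_shift (r + 1) s x)) =
      act B (tuple_prod G r x) (act B (x (Suc r)) (g (tuple_shift (r + 1) s x)))"
    using B.act_mult cup_arguments_closed(2)[OF x'(1) assms(2)] by simp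
  then show ?thesis
    using x' sx rx e1 e2 e3 by (simp add: face_def cup_apply tuple_merge_last)
qed

lemma cup_coboundary_left:
  assumes f: "f \<in> carrier (cochains G A r)" and g: "g \<in> carrier (cochains G B s)"
    and x: "x \<in> tuples G (r + s + 1)"
  shows "cup G B p (r + 1) s (coboundary G A r f) g x =
    alt_prod C (Suc r) (\<lambda>i. cup G B p (r + 1) s (face G A r i f) g x)"
proof -
  have x': "x \<in> tuples G (r + 1 + s)" using x by (simp add: ac_simps)
  have rx: "restrict x {1..r+1} \<in> tuples G (r + 1)"
    by (rule A.tuple_restrict_closed[OF x']) simp
  note b = cup_arguments_closed(4)[OF x' g]
  show ?thesis
    unfolding cup_apply[OF x'] A.coboundary_apply[OF f rx]
    by (rule A.A.alt_prod_hom[OF pairing_hom_left[OF b] C.A.is_group A.face_apply_closed[OF f rx]])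
qed

lemma cup_coboundary_right:
  assumes f: "f \<in> carrier (cochains G A r)" and g: "g \<in> carrier (cochains G B s)"
    and x: "x \<in> tuples G (r + s + 1)"
  shows "cup G B p r (s + 1) f (coboundary G B s g) x =
    alt_prod C (Suc s) (\<lambda>j. cup G B p r (s + 1) f (face G B s j g) x)"
proof -
  have x': "x \<in> tuples G (r + (s + 1))" using x by (simp add: ac_simps)
  have sx: "tuple_shift r (s + 1) x \<in> tuples G (s + 1)"
    by (rule A.tuple_shift_closed[OF x'])
  note a = cup_arguments_closed(1)[OF x' f] and t = cup_arguments_closed(3)[OF x']
  have "(\<lambda>b. p (f (restrict x {1..r})) (act B (tuple_prod G r x) b)) \<in> hom B C"
    using Group.hom_compose[OF B.act_hom[OF t] pairing_hom_right[OF a]] by (simp add: o_def)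
  from B.A.alt_prod_hom[OF this C.A.is_group B.face_apply_closed[OF g sx]]
  show ?thesis
    unfolding cup_apply[OF x'] B.coboundary_apply[OF g sx] .
qed

lemma coboundary_cup:
  assumes f: "f \<in> carrier (cochains G A r)" and g: "g \<in> carrier (cochains G B s)"
  shows "coboundary G C (r + s) (cup G B p r s f g) =
    cup G B p (r + 1) s (coboundary G A r f) g \<otimes>\<^bsub>cochains G C (r + s + 1)\<^esub>
    cup G B p r (s + 1) f (coboundary G B s g) [^]\<^bsub>cochains G C (r + s + 1)\<^esub> ((-1) ^ r :: int)"
proof (rule cochain_eqI[where A = C])
  have c1: "cup G B p (r + 1) s f' g \<in> carrier (cochains G C (r + s + 1))"
    if "f' \<in> carrier (cochains G A (r + 1))" for f'
    using cup_closed[OF that g] by (simp add: ac_simps)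
  have c2: "cup G B p r (s + 1) f g' \<in> carrier (cochains G C (r + s + 1))"
    if "g' \<in> carrier (cochains G B (s + 1))" for g'
    using cup_closed[OF f that] by (simp add: ac_simps)
  note d1 = c1[OF A.coboundary_closed[OF f]] and d2 = c2[OF B.coboundary_closed[OF g]]
  show "cup G B p (r + 1) s (coboundary G A r f) g \<otimes>\<^bsub>cochains G C (r + s + 1)\<^esub>
    cup G B p r (s + 1) f (coboundary G B s g) [^]\<^bsub>cochains G C (r + s + 1)\<^esub> ((-1) ^ r :: int)
      \<in> carrier (cochains G C (r + s + 1))"
    using d1 d2 by (intro C.cochains.m_closed C.cochains.int_pow_closed)
  fix x assume x: "x \<in> tuples G (r + s + 1)"
  define H where "H = (\<lambda>i. face G C (r + s) i (cup G B p r s f g) x)"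
  define L where "L = (\<lambda>i. cup G B p (r + 1) s (face G A r i f) g x)"
  define K where "K = (\<lambda>j. cup G B p r (s + 1) f (face G B s j g) x)"
  have clH: "H i \<in> carrier C" for i
    unfolding H_def by (rule C.face_apply_closed[OF cup_closed[OF f g] x])
  have clL: "L i \<in> carrier C" for i
    unfolding L_def by (rule cochain_closed[OF c1[OF A.face_closed[OF f]] x])
  have clK: "K i \<in> carrier C" for i
    unfolding K_def by (rule cochain_closed[OF c2[OF B.face_closed[OF g]] x])
  define e :: int where "e = (-1) ^ r"
  define P Q where "P = alt_prod C r L" and "Q = alt_prod C s (\<lambda>j. K (Suc j))"
  have [simp]: "P \<in> carrier C" "Q \<in> carrier C" "K 0 \<in> carrier C"
    unfolding P_def Q_def using clL clK by auto
  have "alt_prod C (Suc (r + s)) H = alt_prod C r H \<otimes>\<^bsub>C\<^esub> alt_prod C s (\<lambda>j. H (Suc (r + j))) [^]\<^bsub>C\<^esub> (- e)"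
    using C.A.alt_prod_append[of r s H] clH by (simp add: e_def)
  also have "alt_prod C r H = P"
    unfolding P_def by (rule alt_prod_cong) (simp add: H_def L_def face_cup_left[OF f g x])
  also have "alt_prod C s (\<lambda>j. H (Suc (r + j))) = Q"
    unfolding Q_def by (rule alt_prod_cong) (simp add: H_def K_def face_cup_right[OF f g x])
  \<comment> \<open>\<open>K 0\<close> is the common value from \<open>face_cup_middle\<close>.
    Inserted with both signs, it completes \<open>P\<close> and \<open>Q\<close> to the full
    coboundaries of \<open>f\<close> and \<open>g\<close>.\<close>
  also have "P \<otimes>\<^bsub>C\<^esub> Q [^]\<^bsub>C\<^esub> (- e) =
      (P \<otimes>\<^bsub>C\<^esub> K 0 [^]\<^bsub>C\<^esub> (- e)) \<otimes>\<^bsub>C\<^esub> (K 0 \<otimes>\<^bsub>C\<^esub> inv\<^bsub>C\<^esub> Q) [^]\<^bsub>C\<^esub> e"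
  proof -
    have "inv\<^bsub>C\<^esub> k \<otimes>\<^bsub>C\<^esub> (k \<otimes>\<^bsub>C\<^esub> y) = y" if "k \<in> carrier C" "y \<in> carrier C" for k y
      using that by (simp add: C.A.m_assoc[symmetric])
    then show ?thesis
      by (simp add: C.A.int_pow_distrib C.A.int_pow_inv C.A.int_pow_neg C.A.m_assoc)
  qed
  also have "P \<otimes>\<^bsub>C\<^esub> K 0 [^]\<^bsub>C\<^esub> (- e) = alt_prod C (Suc r) L"
    using face_cup_middle[OF f g x] by (simp add: P_def L_def K_def e_def)
  also have "K 0 \<otimes>\<^bsub>C\<^esub> inv\<^bsub>C\<^esub> Q = alt_prod C (Suc s) K"
    unfolding Q_def using clK by (intro C.A.alt_prod_Suc_shift[symmetric])
  finally show "coboundary G C (r + s) (cup G B p r s f g) x =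
    (cup G B p (r + 1) s (coboundary G A r f) g \<otimes>\<^bsub>cochains G C (r + s + 1)\<^esub>
    cup G B p r (s + 1) f (coboundary G B s g) [^]\<^bsub>cochains G C (r + s + 1)\<^esub> ((-1) ^ r :: int)) x"
    unfolding C.coboundary_apply[OF cup_closed[OF f g] x] cochains_mult_apply[OF x]
      C.cochains_int_pow_apply[OF d2 x] cup_coboundary_left[OF f g x] cup_coboundary_right[OF f g x]
      H_def L_def K_def e_def .
qed (rule C.coboundary_closed[OF cup_closed[OF f g]])

end

section \<open>Cohomology groups\<close>

context comm_group
begin

lemma r_coset_eq_iff:
  assumes "subgroup N G" "x \<in> carrier G" "y \<in> carrier G"
  shows "N #> x = N #> y \<longleftrightarrow> x \<otimes> inv y \<in> N"
proof
  assume "N #> x = N #> y"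
  then have "x \<in> N #> y" using rcos_self[OF assms(2,1)] by simp
  then show "x \<otimes> inv y \<in> N"
    using subgroup.rcos_module_imp[OF assms(1) is_group assms(3)] by simp
next
  assume "x \<otimes> inv y \<in> N"
  then have "x \<in> N #> y"
    using subgroup.rcos_module_rev[OF assms(1) is_group assms(3,2)] by simp
  then show "N #> x = N #> y"
    using repr_independence[OF _ assms(3,1)] by simp
qed

end

context profinite_gmodule
begin

lemma cocycles_iff:
  "f \<in> carrier (cocycles G A r) \<longleftrightarrow>
    f \<in> carrier (cochains G A r) \<and> coboundary G A r f = \<one>\<^bsub>cochains G A (r + 1)\<^esub>"
  by (simp add: cocycles_def kernel_def)

lemma cocycles_mult [simp]: "monoid.mult (cocycles G A r) = monoid.mult (cochains G A r)"
  by (simp add: cocycles_def)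

lemma cocycles_one [simp]: "monoid.one (cocycles G A r) = monoid.one (cochains G A r)"
  by (simp add: cocycles_def)

lemma subgroup_cocycles: "subgroup (carrier (cocycles G A r)) (cochains G A r)"
proof -
  have "group_hom (cochains G A r) (cochains G A (r + 1)) (coboundary G A r)"
    using coboundary_hom by (simp add: group_hom_def group_hom_axioms_def cochains.is_group)
  from group_hom.subgroup_kernel[OF this] show ?thesis
    by (simp add: cocycles_def)
qed

lemma comm_group_cocycles: "comm_group (cocycles G A r)"
proof (rule group.group_comm_groupI)
  show "Group.group (cocycles G A r)"
    using subgroup.subgroup_is_group[OF subgroup_cocycles cochains.is_group, of r] by (simp add: cocycles_def)
  fix f g assume "f \<in> carrier (cocycles G A r)" "g \<in> carrier (cocycles G A r)"
  then have "f \<in> carrier (cochains G A r)" "g \<in> carrier (cochains G A r)"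
    by (simp_all add: cocycles_iff)
  then show "f \<otimes>\<^bsub>cocycles G A r\<^esub> g = g \<otimes>\<^bsub>cocycles G A r\<^esub> f"
    using cochains.m_comm by simp
qed

sublocale cocycles: comm_group "cocycles G A r" for r
  by (rule comm_group_cocycles)

lemma cocycles_inv:
  assumes "f \<in> carrier (cocycles G A r)"
  shows "inv\<^bsub>cocycles G A r\<^esub> f = inv\<^bsub>cochains G A r\<^esub> f"
  using cochains.m_inv_consistent[OF subgroup_cocycles assms] by (simp add: cocycles_def)

lemma subgroup_coboundaries: "subgroup (coboundaries G A r) (cocycles G A r)"
proof (cases r)
  case 0
  then show ?thesis using cocycles.triv_subgroup[of 0] by simp
next
  case (Suc n)
  \<comment> \<open>By d d = 0 the coboundary is a homomorphism into the cocycles, so its image is a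
    subgroup there.\<close>
  have h: "coboundary G A n \<in> hom (cochains G A n) (cocycles G A (Suc n))"
  proof (rule homI)
    fix f assume f: "f \<in> carrier (cochains G A n)"
    then show "coboundary G A n f \<in> carrier (cocycles G A (Suc n))"
      using coboundary_closed[OF f] coboundary_coboundary[OF f] by (simp add: cocycles_iff)
  next
    fix f g assume "f \<in> carrier (cochains G A n)" "g \<in> carrier (cochains G A n)"
    then show "coboundary G A n (f \<otimes>\<^bsub>cochains G A n\<^esub> g) =
        coboundary G A n f \<otimes>\<^bsub>cocycles G A (Suc n)\<^esub> coboundary G A n g"
      using hom_mult[OF coboundary_hom] by simp
  qed
  then have "group_hom (cochains G A n) (cocycles G A (Suc n)) (coboundary G A n)"
    by (simp add: group_hom_def group_hom_axioms_def cochains.is_group cocycles.is_group)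
  from group_hom.img_is_subgroup[OF this] show ?thesis
    using Suc by simp
qed

lemma coboundaries_subset: "coboundaries G A r \<subseteq> carrier (cocycles G A r)"
  by (rule subgroup.subset[OF subgroup_coboundaries])

lemma normal_coboundaries: "coboundaries G A r \<lhd> cocycles G A r"
  by (simp add: cocycles.normal_iff_subgroup subgroup_coboundaries)

lemma comm_group_cohomology: "comm_group (cohomology G A r)"
  unfolding cohomology_def by (rule cocycles.abelian_FactGroup[OF subgroup_coboundaries])

sublocale cohomology: comm_group "cohomology G A r" for r
  by (rule comm_group_cohomology)

lemma carrier_cohomology: "carrier (cohomology G A r) = coh_class G A r ` carrier (cocycles G A r)"
  by (simp add: cohomology_def carrier_FactGroup coh_class_def)

lemma coh_class_hom: "coh_class G A r \<in> hom (cocycles G A r) (cohomology G A r)"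
  using normal.r_coset_hom_Mod[OF normal_coboundaries] by (simp add: coh_class_def[abs_def] cohomology_def)

lemma coh_class_mult:
  "\<lbrakk>f \<in> carrier (cocycles G A r); g \<in> carrier (cocycles G A r)\<rbrakk> \<Longrightarrow>
    coh_class G A r (f \<otimes>\<^bsub>cochains G A r\<^esub> g) = coh_class G A r f \<otimes>\<^bsub>cohomology G A r\<^esub> coh_class G A r g"
  using hom_mult[OF coh_class_hom] by simp

lemma coh_class_closed:
  "f \<in> carrier (cocycles G A r) \<Longrightarrow> coh_class G A r f \<in> carrier (cohomology G A r)"
  by (simp add: carrier_cohomology)

lemma coh_class_eq_iff:
  assumes "f \<in> carrier (cocycles G A r)" "g \<in> carrier (cocycles G A r)"
  shows "coh_class G A r f = coh_class G A r g \<longleftrightarrow>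
    f \<otimes>\<^bsub>cochains G A r\<^esub> inv\<^bsub>cochains G A r\<^esub> g \<in> coboundaries G A r"
  using cocycles.r_coset_eq_iff[OF subgroup_coboundaries assms] cocycles_inv[OF assms(2)]
  by (simp add: coh_class_def)

lemma coh_class_eq_one_iff:
  assumes "f \<in> carrier (cocycles G A r)"
  shows "coh_class G A r f = \<one>\<^bsub>cohomology G A r\<^esub> \<longleftrightarrow> f \<in> coboundaries G A r"
  using cocycles.coset_join1[OF _ assms subgroup_coboundaries]
    cocycles.coset_join2[OF assms subgroup_coboundaries]
  by (auto simp: coh_class_def cohomology_def)

text \<open>\<open>aug_cup\<close> expresses its choice of lifts by membership in a class; this
  turns such a condition into an equation between classes.\<close>

lemma mem_coh_class_iff:
  assumes "f \<in> carrier (cocycles G A r)"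
  shows "g \<in> coh_class G A r f \<longleftrightarrow> g \<in> carrier (cocycles G A r) \<and> coh_class G A r g = coh_class G A r f"
proof
  assume g: "g \<in> coh_class G A r f"
  then have "g \<in> carrier (cocycles G A r)"
    using cocycles.r_coset_subset_G[OF coboundaries_subset assms] by (auto simp: coh_class_def)
  then show "g \<in> carrier (cocycles G A r) \<and> coh_class G A r g = coh_class G A r f"
    using g cocycles.repr_independence[OF _ assms subgroup_coboundaries] by (simp add: coh_class_def)
next
  assume "g \<in> carrier (cocycles G A r) \<and> coh_class G A r g = coh_class G A r f"
  then show "g \<in> coh_class G A r f"
    using cocycles.rcos_self[OF _ subgroup_coboundaries] by (auto simp: coh_class_def)
qed

lemma mem_cohomology:
  assumes "\<alpha> \<in> carrier (cohomology G A r)" "f \<in> \<alpha>"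
  shows "f \<in> carrier (cocycles G A r)" "coh_class G A r f = \<alpha>"
  using assms by (auto simp: carrier_cohomology mem_coh_class_iff)

lemma cohomology_nonempty:
  assumes "\<alpha> \<in> carrier (cohomology G A r)"
  obtains f where "f \<in> \<alpha>" "f \<in> carrier (cocycles G A r)" "\<alpha> = coh_class G A r f"
  using assms by (auto simp: carrier_cohomology mem_coh_class_iff)

end

section \<open>Induced maps on cohomology\<close>

context profinite_gmod_hom
begin

lemma cochain_map_group_hom: "group_hom (cochains G A r) (cochains G B r) (cochain_map G r h)"
  using cochain_map_hom by (simp add: group_hom_def group_hom_axioms_def A.cochains.is_group B.cochains.is_group)

lemma cochain_map_one: "cochain_map G r h \<one>\<^bsub>cochains G A r\<^esub> = \<one>\<^bsub>cochains G B r\<^esub>"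
  by (rule hom_one[OF cochain_map_hom A.cochains.is_group B.cochains.is_group])

lemma cochain_map_cocycle:
  assumes "f \<in> carrier (cocycles G A r)"
  shows "cochain_map G r h f \<in> carrier (cocycles G B r)"
  using assms cochain_map_in_cochains coboundary_cochain_map cochain_map_one
  by (simp add: A.cocycles_iff B.cocycles_iff)

lemma cochain_map_coboundaries:
  assumes "f \<in> coboundaries G A r"
  shows "cochain_map G r h f \<in> coboundaries G B r"
proof (cases r)
  case 0
  then show ?thesis using assms cochain_map_one by simp
next
  case (Suc n)
  then obtain u where u: "u \<in> carrier (cochains G A n)" "f = coboundary G A n u"
    using assms by auto
  then have "cochain_map G r h f = coboundary G B n (cochain_map G n h u)"
    using coboundary_cochain_map Suc by simp
  then show ?thesis using u cochain_map_in_cochains Suc by auto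
qed

text \<open>\<open>coh_map\<close> is \<open>the_elem\<close> of an image, which is a singleton
  because two representatives differ by a coboundary and \<open>h\<close> carries coboundaries to
  coboundaries.\<close>

lemma coh_map_coh_class:
  assumes f: "f \<in> carrier (cocycles G A r)"
  shows "coh_map G B r h (coh_class G A r f) = coh_class G B r (cochain_map G r h f)"
proof -
  have eq: "coh_class G B r (cochain_map G r h g) = coh_class G B r (cochain_map G r h f)"
    if "g \<in> coh_class G A r f" for g
  proof -
    have g: "g \<in> carrier (cocycles G A r)" "coh_class G A r g = coh_class G A r f"
      using that f by (auto simp: A.mem_coh_class_iff)
    have gf: "g \<in> carrier (cochains G A r)" "f \<in> carrier (cochains G A r)"
      using f g by (auto simp: A.cocycles_iff)
    have "cochain_map G r h (g \<otimes>\<^bsub>cochains G A r\<^esub> inv\<^bsub>cochains G A r\<^esub> f) \<in> coboundaries G B r"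
      using g f by (intro cochain_map_coboundaries) (simp add: A.coh_class_eq_iff)
    moreover have "cochain_map G r h (g \<otimes>\<^bsub>cochains G A r\<^esub> inv\<^bsub>cochains G A r\<^esub> f) =
        cochain_map G r h g \<otimes>\<^bsub>cochains G B r\<^esub> inv\<^bsub>cochains G B r\<^esub> cochain_map G r h f"
      using gf group_hom.hom_inv[OF cochain_map_group_hom gf(2)]
      by (simp add: hom_mult[OF cochain_map_hom])
    ultimately show ?thesis
      using cochain_map_cocycle f g by (simp add: B.coh_class_eq_iff)
  qed
  have "(\<lambda>g. coh_class G B r (cochain_map G r h g)) ` coh_class G A r f =
      (\<lambda>g. coh_class G B r (cochain_map G r h f)) ` coh_class G A r f"
    by (rule image_cong[OF refl eq])
  also have "\<dots> = {coh_class G B r (cochain_map G r h f)}"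
    by (rule image_constant[of f]) (use f in \<open>simp add: A.mem_coh_class_iff\<close>)
  finally show ?thesis by (simp add: coh_map_def)
qed

lemma coh_map_hom: "coh_map G B r h \<in> hom (cohomology G A r) (cohomology G B r)"
proof (rule homI)
  fix \<alpha> assume "\<alpha> \<in> carrier (cohomology G A r)"
  then show "coh_map G B r h \<alpha> \<in> carrier (cohomology G B r)"
    by (auto simp: A.carrier_cohomology coh_map_coh_class cochain_map_cocycle intro!: B.coh_class_closed)
next
  fix \<alpha> \<beta> assume "\<alpha> \<in> carrier (cohomology G A r)" "\<beta> \<in> carrier (cohomology G A r)"
  then obtain f g where f: "f \<in> carrier (cocycles G A r)" "\<alpha> = coh_class G A r f"
    and g: "g \<in> carrier (cocycles G A r)" "\<beta> = coh_class G A r g"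
    by (auto simp: A.carrier_cohomology)
  have fg: "f \<otimes>\<^bsub>cochains G A r\<^esub> g \<in> carrier (cocycles G A r)"
    using A.cocycles.m_closed[OF f(1) g(1)] by simp
  have fg': "f \<in> carrier (cochains G A r)" "g \<in> carrier (cochains G A r)"
    using f g by (auto simp: A.cocycles_iff)
  show "coh_map G B r h (\<alpha> \<otimes>\<^bsub>cohomology G A r\<^esub> \<beta>) =
      coh_map G B r h \<alpha> \<otimes>\<^bsub>cohomology G B r\<^esub> coh_map G B r h \<beta>"
    using f g fg fg' cochain_map_cocycle
    by (simp add: A.coh_class_mult[symmetric] coh_map_coh_class hom_mult[OF cochain_map_hom] B.coh_class_mult)
qed

end

section \<open>Connecting cochains\<close>

text \<open>Serves the two sequences of the Tate product as well as the two rows of the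
  diagram.\<close>

locale profinite_short_exact = profinite_group G for G :: "'g tgroup" (structure) +
  fixes A :: "('g, 'a) gmodule" and i :: "'a \<Rightarrow> 'b" and B :: "('g, 'b) gmodule"
    and j :: "'b \<Rightarrow> 'c" and C :: "('g, 'c) gmodule"
  assumes exact: "short_exact G A i B j C"
begin

sublocale A: profinite_gmodule G A
  using short_exact_gmodules[OF profinite_group_axioms exact] by simp
sublocale B: profinite_gmodule G B
  using short_exact_gmodules[OF profinite_group_axioms exact] by simp
sublocale C: profinite_gmodule G C
  using short_exact_gmodules[OF profinite_group_axioms exact] by simp
sublocale i: profinite_gmod_hom G A B i
  by unfold_locales (use exact in \<open>simp add: short_exact_def\<close>)
sublocale j: profinite_gmod_hom G B C j
  by unfold_locales (use exact in \<open>simp add: short_exact_def\<close>)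

lemma inj_i: "inj_on i (carrier A)"
  and image_i: "i ` carrier A = kernel B C j"
  and surj_j: "j ` carrier B = carrier C"
  using exact unfolding short_exact_def by blast+

lemma j_i: "a \<in> carrier A \<Longrightarrow> j (i a) = \<one>\<^bsub>C\<^esub>"
proof -
  assume "a \<in> carrier A"
  then have "i a \<in> kernel B C j" unfolding image_i[symmetric] by (rule imageI)
  then show ?thesis by (simp add: kernel_def)
qed

lemma pullback_i:
  assumes "f \<in> carrier (cochains G A r)"
  shows "cochain_pullback G A r i (cochain_map G r i f) = f"
proof (rule extensionalityI[where A = "tuples G r"])
  fix x assume x: "x \<in> tuples G r"
  then show "cochain_pullback G A r i (cochain_map G r i f) x = f x"
    using inj_i cochain_closed[OF assms x] by (simp add: cochain_pullback_def cochain_map_def)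
qed (use cochain_extensional[OF assms] in \<open>auto simp: cochain_pullback_def cochain_map_def\<close>)

lemma j_cochain_map_i:
  assumes "f \<in> carrier (cochains G A r)"
  shows "cochain_map G r j (cochain_map G r i f) = \<one>\<^bsub>cochains G C r\<^esub>"
proof (rule extensionalityI[where A = "tuples G r"])
  fix x assume x: "x \<in> tuples G r"
  then show "cochain_map G r j (cochain_map G r i f) x = \<one>\<^bsub>cochains G C r\<^esub> x"
    using j_i[OF cochain_closed[OF assms x]] by (simp add: cochain_map_apply cochains_one_apply)
qed (auto simp: cochain_map_def cochains_def)

text \<open>Pointwise exactness at \<open>B\<close>, transferred to cochains.\<close>

lemma pullback_closed:
  assumes f: "f \<in> carrier (cochains G B r)" and j: "cochain_map G r j f = \<one>\<^bsub>cochains G C r\<^esub>"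
  shows "cochain_pullback G A r i f \<in> carrier (cochains G A r)"
    and "cochain_map G r i (cochain_pullback G A r i f) = f"
proof -
  have im: "f x \<in> i ` carrier A" if "x \<in> tuples G r" for x
  proof -
    have "j (f x) = \<one>\<^bsub>C\<^esub>"
      using fun_cong[OF j, of x] that by (simp add: cochain_map_apply cochains_one_apply)
    then show ?thesis
      unfolding image_i using cochain_closed[OF f that] by (simp add: kernel_def)
  qed
  \<comment> \<open>\<open>inv_into\<close> is meaningful only on the image of \<open>i\<close>, so
    the codomain of \<open>f\<close> is first narrowed to this image, again with the discrete
    topology.\<close>
  have "openin (tuples_top G r) {x \<in> tuples G r. f x \<in> U}" if "U \<subseteq> i ` carrier A" for U
  proof -
    have "U \<subseteq> carrier B" using that i.map_closed by auto
    then show ?thesis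
      using cochain_continuous[OF f] by (simp add: continuous_map_def)
  qed
  then have "continuous_map (tuples_top G r) (discrete_topology (i ` carrier A)) f"
    using im by (auto simp: continuous_map_def)
  then have "continuous_map (tuples_top G r) (discrete_topology (carrier A)) (\<lambda>x. inv_into (carrier A) i (f x))"
    by (rule continuous_map_discrete_fun) (rule inv_into_into)
  from restrict_cochain[OF this]
  show "cochain_pullback G A r i f \<in> carrier (cochains G A r)"
    by (simp add: cochain_pullback_def cochain_map_def)
  show "cochain_map G r i (cochain_pullback G A r i f) = f"
    by (rule extensionalityI[where A = "tuples G r"])
      (use cochain_extensional[OF f] f_inv_into_f[OF im] in \<open>auto simp: cochain_pullback_def cochain_map_def\<close>)
qed

lemma cochain_map_i_cancel:
  assumes "f \<in> carrier (cochains G A r)" "g \<in> carrier (cochains G A r)"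
    and "cochain_map G r i f = cochain_map G r i g"
  shows "f = g"
  using pullback_i[OF assms(1)] unfolding assms(3) pullback_i[OF assms(2)] ..

text \<open>These are exactly the cochains that the augmented cup product may choose as
  \<open>f\<close> or \<open>g\<close>.\<close>

definition cocycle_lifts :: "nat \<Rightarrow> ((nat \<Rightarrow> 'g) \<Rightarrow> 'b) set" where
  "cocycle_lifts r = {f \<in> carrier (cochains G B r). cochain_map G r j f \<in> carrier (cocycles G C r)}"

text \<open>The snake lemma on cochains: for \<open>f\<close> in \<open>cocycle_lifts r\<close> this
  cocycle represents the image of the class of \<open>j f\<close> under the connecting homomorphism
  from degree \<open>r\<close> of \<open>C\<close> to degree \<open>r + 1\<close> of
  \<open>A\<close>.\<close>

definition connecting :: "nat \<Rightarrow> ((nat \<Rightarrow> 'g) \<Rightarrow> 'b) \<Rightarrow> (nat \<Rightarrow> 'g) \<Rightarrow> 'a" where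
  "connecting r f = cochain_pullback G A (r + 1) i (coboundary G B r f)"

lemma cocycle_lifts_cochain: "f \<in> cocycle_lifts r \<Longrightarrow> f \<in> carrier (cochains G B r)"
  by (simp add: cocycle_lifts_def)

lemma connecting_closed:
  assumes "f \<in> cocycle_lifts r"
  shows "connecting r f \<in> carrier (cochains G A (r + 1))"
    and "cochain_map G (r + 1) i (connecting r f) = coboundary G B r f"
proof -
  have "cochain_map G (r + 1) j (coboundary G B r f) = \<one>\<^bsub>cochains G C (r + 1)\<^esub>"
    using assms j.coboundary_cochain_map[of f r] by (simp add: cocycle_lifts_def C.cocycles_iff)
  from pullback_closed[OF _ this] show "connecting r f \<in> carrier (cochains G A (r + 1))"
    "cochain_map G (r + 1) i (connecting r f) = coboundary G B r f"
    using B.coboundary_closed[OF cocycle_lifts_cochain[OF assms]] by (simp_all add: connecting_def)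
qed

text \<open>As \<open>i\<close> is injective on cochains, the equation determines the connecting
  cochain, so formulas for it can be proved without touching \<open>inv_into\<close>.\<close>

lemma connecting_eqI:
  assumes "f \<in> cocycle_lifts r" "u \<in> carrier (cochains G A (r + 1))"
    "cochain_map G (r + 1) i u = coboundary G B r f"
  shows "connecting r f = u"
  using cochain_map_i_cancel[OF connecting_closed(1)[OF assms(1)] assms(2)] connecting_closed(2)[OF assms(1)] assms(3)
  by simp

text \<open>After applying the injective \<open>i\<close> this is d d = 0 in
  \<open>B\<close>.\<close>

lemma coboundary_connecting:
  assumes "f \<in> cocycle_lifts r"
  shows "coboundary G A (r + 1) (connecting r f) = \<one>\<^bsub>cochains G A (r + 2)\<^esub>"
proof (rule cochain_map_i_cancel)
  show "cochain_map G (r + 2) i (coboundary G A (r + 1) (connecting r f)) =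
      cochain_map G (r + 2) i \<one>\<^bsub>cochains G A (r + 2)\<^esub>"
    using i.coboundary_cochain_map[OF connecting_closed(1)[OF assms]] connecting_closed(2)[OF assms]
      B.coboundary_coboundary[OF cocycle_lifts_cochain[OF assms]] i.cochain_map_one[of "r + 2"]
    by simp
  show "coboundary G A (r + 1) (connecting r f) \<in> carrier (cochains G A (r + 2))"
    using A.coboundary_closed[OF connecting_closed(1)[OF assms]] by simp
qed (rule A.cochains_one_closed)

lemma subgroup_cocycle_lifts: "subgroup (cocycle_lifts r) (cochains G B r)"
proof (rule B.cochains.subgroupI)
  have "\<one>\<^bsub>cochains G B r\<^esub> \<in> cocycle_lifts r"
    using C.cocycles.one_closed[of r] by (simp add: cocycle_lifts_def j.cochain_map_one)
  then show "cocycle_lifts r \<noteq> {}" by blast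
next
  fix f assume f: "f \<in> cocycle_lifts r"
  then have "cochain_map G r j (inv\<^bsub>cochains G B r\<^esub> f) = inv\<^bsub>cochains G C r\<^esub> cochain_map G r j f"
    using group_hom.hom_inv[OF j.cochain_map_group_hom] by (simp add: cocycle_lifts_def)
  also have "\<dots> \<in> carrier (cocycles G C r)"
    using f subgroup.m_inv_closed[OF C.subgroup_cocycles] by (simp add: cocycle_lifts_def)
  finally show "inv\<^bsub>cochains G B r\<^esub> f \<in> cocycle_lifts r"
    using f by (simp add: cocycle_lifts_def)
next
  fix f g assume fg: "f \<in> cocycle_lifts r" "g \<in> cocycle_lifts r"
  then show "f \<otimes>\<^bsub>cochains G B r\<^esub> g \<in> cocycle_lifts r"
    using subgroup.m_closed[OF C.subgroup_cocycles] by (simp add: cocycle_lifts_def hom_mult[OF j.cochain_map_hom])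
qed (simp add: cocycle_lifts_def subset_iff)

lemma connecting_mult:
  assumes "f \<in> cocycle_lifts r" "g \<in> cocycle_lifts r"
  shows "connecting r (f \<otimes>\<^bsub>cochains G B r\<^esub> g) =
    connecting r f \<otimes>\<^bsub>cochains G A (r + 1)\<^esub> connecting r g"
proof (rule connecting_eqI)
  show "cochain_map G (r + 1) i (connecting r f \<otimes>\<^bsub>cochains G A (r + 1)\<^esub> connecting r g) =
      coboundary G B r (f \<otimes>\<^bsub>cochains G B r\<^esub> g)"
    using connecting_closed[OF assms(1)] connecting_closed[OF assms(2)] assms
    by (simp add: hom_mult[OF i.cochain_map_hom] hom_mult[OF B.coboundary_hom] cocycle_lifts_cochain)
  show "f \<otimes>\<^bsub>cochains G B r\<^esub> g \<in> cocycle_lifts r"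
    by (rule subgroup.m_closed[OF subgroup_cocycle_lifts assms])
  show "connecting r f \<otimes>\<^bsub>cochains G A (r + 1)\<^esub> connecting r g \<in> carrier (cochains G A (r + 1))"
    by (rule A.cochains.m_closed[OF connecting_closed(1)[OF assms(1)] connecting_closed(1)[OF assms(2)]])
qed

lemma cocycle_lift_exists:
  assumes "u \<in> carrier (cocycles G C r)"
  obtains f where "f \<in> cocycle_lifts r" "cochain_map G r j f = u"
proof -
  have "u \<in> carrier (cochains G C r)" using assms by (simp add: C.cocycles_iff)
  then obtain f where "f \<in> carrier (cochains G B r)" "cochain_map G r j f = u"
    by (rule cochain_map_lift[OF surj_j])
  with assms show ?thesis by (intro that[of f]) (auto simp: cocycle_lifts_def)
qed

lemma image_i_cocycle_lift:
  assumes f: "f \<in> carrier (cochains G A r)"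
  shows "cochain_map G r i f \<in> cocycle_lifts r" "connecting r (cochain_map G r i f) = coboundary G A r f"
proof -
  show 1: "cochain_map G r i f \<in> cocycle_lifts r"
    using i.cochain_map_in_cochains[OF f] C.cocycles.one_closed[of r]
    unfolding cocycle_lifts_def C.cocycles_one by (simp add: j_cochain_map_i[OF f])
  show "connecting r (cochain_map G r i f) = coboundary G A r f"
    using f by (intro connecting_eqI[OF 1] A.coboundary_closed) (simp_all add: i.coboundary_cochain_map)
qed

lemma cocycle_lift_cocycle:
  assumes "f \<in> carrier (cocycles G B r)"
  shows "f \<in> cocycle_lifts r" "connecting r f = \<one>\<^bsub>cochains G A (r + 1)\<^esub>"
proof -
  show 1: "f \<in> cocycle_lifts r"
    using assms j.cochain_map_cocycle[OF assms] unfolding cocycle_lifts_def B.cocycles_iff by blast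
  show "connecting r f = \<one>\<^bsub>cochains G A (r + 1)\<^esub>"
  proof (rule connecting_eqI[OF 1])
    show "\<one>\<^bsub>cochains G A (r + 1)\<^esub> \<in> carrier (cochains G A (r + 1))"
      by (rule A.cochains_one_closed)
    show "cochain_map G (r + 1) i \<one>\<^bsub>cochains G A (r + 1)\<^esub> = coboundary G B r f"
      using assms unfolding B.cocycles_iff i.cochain_map_one by simp
  qed
qed

text \<open>If \<open>j f\<close> is the coboundary of \<open>v\<close>, the coboundary
  \<open>u\<close> of a lift of \<open>v\<close> has the same image as \<open>f\<close>, so the
  quotient of \<open>f\<close> by \<open>u\<close> comes from \<open>A\<close>. In degree 0 the only
  coboundary is the unit, and \<open>u\<close> is taken to be the unit.\<close>

lemma coboundary_lift_decomposition:
  assumes f: "f \<in> carrier (cochains G B r)" and j: "cochain_map G r j f \<in> coboundaries G C r"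
  obtains f' u where "f' \<in> carrier (cochains G A r)" "u \<in> coboundaries G B r"
    "f = cochain_map G r i f' \<otimes>\<^bsub>cochains G B r\<^esub> u"
proof -
  obtain u where u: "u \<in> coboundaries G B r" "cochain_map G r j f = cochain_map G r j u"
  proof (cases r)
    case 0
    show ?thesis
    proof (rule that)
      show "\<one>\<^bsub>cochains G B r\<^esub> \<in> coboundaries G B r"
        using 0 by simp
      show "cochain_map G r j f = cochain_map G r j \<one>\<^bsub>cochains G B r\<^esub>"
        using j 0 unfolding j.cochain_map_one by simp
    qed
  next
    case (Suc n)
    then obtain v where v: "v \<in> carrier (cochains G C n)" "cochain_map G r j f = coboundary G C n v"
      using j by auto
    obtain w where w: "w \<in> carrier (cochains G B n)" "cochain_map G n j w = v"
      using cochain_map_lift[OF surj_j v(1)] .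
    show ?thesis
    proof (rule that)
      show "coboundary G B n w \<in> coboundaries G B r"
        using w(1) Suc by simp
      show "cochain_map G r j f = cochain_map G r j (coboundary G B n w)"
        using j.coboundary_cochain_map[OF w(1)] w(2) v(2) Suc by simp
    qed
  qed
  then have u': "u \<in> carrier (cochains G B r)"
    using subsetD[OF B.coboundaries_subset] by (simp add: B.cocycles_iff)
  define v where "v = f \<otimes>\<^bsub>cochains G B r\<^esub> inv\<^bsub>cochains G B r\<^esub> u"
  have v: "v \<in> carrier (cochains G B r)" unfolding v_def using f u' by simp
  have fv: "f = v \<otimes>\<^bsub>cochains G B r\<^esub> u"
    unfolding v_def using f u' by (simp add: B.cochains.m_assoc)
  have ju: "cochain_map G r j u \<in> carrier (cochains G C r)"
    by (rule j.cochain_map_in_cochains[OF u'])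
  have "cochain_map G r j v \<otimes>\<^bsub>cochains G C r\<^esub> cochain_map G r j u = cochain_map G r j u"
    using hom_mult[OF j.cochain_map_hom v u'] fv u(2) by simp
  then have "cochain_map G r j v = \<one>\<^bsub>cochains G C r\<^esub>"
    using C.cochains.r_cancel_one[OF ju j.cochain_map_in_cochains[OF v]] by simp
  from pullback_closed[OF v this] fv show ?thesis
    using that[of "cochain_pullback G A r i v" u] u(1) by simp
qed

end

section \<open>The augmented cup product\<close>

locale profinite_tate_product = profinite_group G + tate_product G A' iA A jA A'' B' iB B jB B'' C p q
  for G :: "'g tgroup" (structure)
    and A' :: "('g, 'a1) gmodule" and iA :: "'a1 \<Rightarrow> 'a" and A :: "('g, 'a) gmodule"
    and jA :: "'a \<Rightarrow> 'a2" and A'' :: "('g, 'a2) gmodule"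
    and B' :: "('g, 'b1) gmodule" and iB :: "'b1 \<Rightarrow> 'b" and B :: "('g, 'b) gmodule"
    and jB :: "'b \<Rightarrow> 'b2" and B'' :: "('g, 'b2) gmodule"
    and C :: "('g, 'c) gmodule" and p :: "'a1 \<Rightarrow> 'b \<Rightarrow> 'c" and q :: "'a \<Rightarrow> 'b1 \<Rightarrow> 'c"
begin

sublocale a: profinite_short_exact G A' iA A jA A''
  by unfold_locales (rule exact_A)
sublocale b: profinite_short_exact G B' iB B jB B''
  by unfold_locales (rule exact_B)
sublocale C: profinite_gmodule G C
  using module_C profinite_group_axioms by (simp add: profinite_gmodule_def)
sublocale p: cup_pairing G A' B C p
  by unfold_locales (rule bilinear_p)
sublocale q: cup_pairing G A B' C q
  by unfold_locales (rule bilinear_q)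

text \<open>The one place where \<open>coincide\<close> enters. The cup product acts on its second
  factor before pairing, so \<open>iB\<close> has to be moved past the action by equivariance
  first.\<close>

lemma cup_coincide:
  assumes u: "u \<in> carrier (cochains G A' r)" and v: "v \<in> carrier (cochains G B' s)"
  shows "cup G B p r s u (cochain_map G s iB v) = cup G B' q r s (cochain_map G r iA u) v"
proof (rule cochain_eqI[where A = C])
  fix x assume x: "x \<in> tuples G (r + s)"
  have rx: "restrict x {1..r} \<in> tuples G r"
    by (rule tuple_restrict_closed[OF x]) simp
  note cu = p.cup_arguments_closed(1)[OF x u] and cv = q.cup_arguments_closed(2,3)[OF x] q.cup_arguments_closed(4)[OF x v]
  have "p (u (restrict x {1..r})) (act B (tuple_prod G r x) (iB (v (tuple_shift r s x)))) =
      p (u (restrict x {1..r})) (iB (act B' (tuple_prod G r x) (v (tuple_shift r s x))))"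
    by (simp only: b.i.map_act[OF cv(2) cv(1)[OF v]])
  also have "\<dots> = q (iA (u (restrict x {1..r}))) (act B' (tuple_prod G r x) (v (tuple_shift r s x)))"
    by (rule coincide[OF cu cv(3)])
  finally show "cup G B p r s u (cochain_map G s iB v) x = cup G B' q r s (cochain_map G r iA u) v x"
    by (simp only: p.cup_apply[OF x] q.cup_apply[OF x] cochain_map_apply[OF rx]
        cochain_map_apply[OF tuple_shift_closed[OF x]])
qed (rule p.cup_closed[OF u b.i.cochain_map_in_cochains[OF v]]
    q.cup_closed[OF a.i.cochain_map_in_cochains[OF u] v])+

abbreviation aug_left :: "nat \<Rightarrow> nat \<Rightarrow> ((nat \<Rightarrow> 'g) \<Rightarrow> 'a) \<Rightarrow> ((nat \<Rightarrow> 'g) \<Rightarrow> 'b) \<Rightarrow> (nat \<Rightarrow> 'g) \<Rightarrow> 'c" where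
  "aug_left r s f g \<equiv> cup G B p (r + 1) s (a.connecting r f) g"

abbreviation aug_right :: "nat \<Rightarrow> nat \<Rightarrow> ((nat \<Rightarrow> 'g) \<Rightarrow> 'a) \<Rightarrow> ((nat \<Rightarrow> 'g) \<Rightarrow> 'b) \<Rightarrow> (nat \<Rightarrow> 'g) \<Rightarrow> 'c" where
  "aug_right r s f g \<equiv> cup G B' q r (s + 1) f (b.connecting s g)"

abbreviation aug :: "nat \<Rightarrow> nat \<Rightarrow> ((nat \<Rightarrow> 'g) \<Rightarrow> 'a) \<Rightarrow> ((nat \<Rightarrow> 'g) \<Rightarrow> 'b) \<Rightarrow> (nat \<Rightarrow> 'g) \<Rightarrow> 'c" where
  "aug r s \<equiv> aug_cup_cochain G A' iA A B' iB B C p q r s"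

lemma aug_eq:
  "aug r s f g = aug_left r s f g \<otimes>\<^bsub>cochains G C (r + s + 1)\<^esub>
    aug_right r s f g [^]\<^bsub>cochains G C (r + s + 1)\<^esub> ((-1) ^ r :: int)"
  by (simp only: aug_cup_cochain_def a.connecting_def b.connecting_def)

text \<open>Cochain groups are indexed by degree, and cup products produce \<open>r + 1 + s\<close>
  and \<open>r + (s + 1)\<close>; both are brought to the form \<open>r + s + 1\<close>.\<close>

lemma add_1_left: "n + 1 + m = n + m + 1" and add_1_right: "n + (m + 1) = n + m + 1" for n m :: nat
  by simp_all

lemma aug_left_closed:
  assumes "f \<in> a.cocycle_lifts r" "g \<in> carrier (cochains G B s)"
  shows "aug_left r s f g \<in> carrier (cochains G C (r + s + 1))"
  using p.cup_closed[OF a.connecting_closed(1)[OF assms(1)] assms(2)] by (simp only: add_1_left[of r s])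

lemma aug_right_closed:
  assumes "f \<in> carrier (cochains G A r)" "g \<in> b.cocycle_lifts s"
  shows "aug_right r s f g \<in> carrier (cochains G C (r + s + 1))"
  using q.cup_closed[OF assms(1) b.connecting_closed(1)[OF assms(2)]] by (simp only: add_1_right[of r s])

lemmas lifts_cochain = a.cocycle_lifts_cochain b.cocycle_lifts_cochain

lemma aug_closed:
  assumes "f \<in> a.cocycle_lifts r" "g \<in> b.cocycle_lifts s"
  shows "aug r s f g \<in> carrier (cochains G C (r + s + 1))"
  unfolding aug_eq
  by (intro C.cochains.m_closed C.cochains.int_pow_closed aug_left_closed aug_right_closed lifts_cochain assms)

text \<open>The left term is additive in \<open>f\<close> because the connecting cochain is, the
  right term directly; both then use bilinearity of the cup product.\<close>

lemma aug_mult_left: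
  assumes f: "f \<in> a.cocycle_lifts r" and f': "f' \<in> a.cocycle_lifts r" and g: "g \<in> b.cocycle_lifts s"
  shows "aug r s (f \<otimes>\<^bsub>cochains G A r\<^esub> f') g = aug r s f g \<otimes>\<^bsub>cochains G C (r + s + 1)\<^esub> aug r s f' g"
proof -
  note gc = lifts_cochain(2)[OF g] and fc = lifts_cochain(1)[OF f] and fc' = lifts_cochain(1)[OF f']
  have 1: "aug_left r s (f \<otimes>\<^bsub>cochains G A r\<^esub> f') g =
      aug_left r s f g \<otimes>\<^bsub>cochains G C (r + s + 1)\<^esub> aug_left r s f' g"
    unfolding a.connecting_mult[OF f f'] add_1_left[of r s, symmetric]
    by (rule hom_mult[OF p.cup_hom_left[OF gc] a.connecting_closed(1)[OF f] a.connecting_closed(1)[OF f']])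
  have 2: "aug_right r s (f \<otimes>\<^bsub>cochains G A r\<^esub> f') g =
      aug_right r s f g \<otimes>\<^bsub>cochains G C (r + s + 1)\<^esub> aug_right r s f' g"
    unfolding add_1_right[of r s, symmetric]
    by (rule hom_mult[OF q.cup_hom_left[OF b.connecting_closed(1)[OF g]] fc fc'])
  note cl = aug_left_closed[OF f gc] aug_left_closed[OF f' gc] aug_right_closed[OF fc g] aug_right_closed[OF fc' g]
  show ?thesis
    unfolding aug_eq 1 2 C.cochains.int_pow_distrib[OF cl(3,4)]
    by (simp only: C.cochains.m_ac C.cochains.m_closed C.cochains.int_pow_closed cl)
qed

lemma aug_mult_right:
  assumes f: "f \<in> a.cocycle_lifts r" and g: "g \<in> b.cocycle_lifts s" and g': "g' \<in> b.cocycle_lifts s"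
  shows "aug r s f (g \<otimes>\<^bsub>cochains G B s\<^esub> g') = aug r s f g \<otimes>\<^bsub>cochains G C (r + s + 1)\<^esub> aug r s f g'"
proof -
  note fc = lifts_cochain(1)[OF f] and gc = lifts_cochain(2)[OF g] and gc' = lifts_cochain(2)[OF g']
  have 1: "aug_left r s f (g \<otimes>\<^bsub>cochains G B s\<^esub> g') =
      aug_left r s f g \<otimes>\<^bsub>cochains G C (r + s + 1)\<^esub> aug_left r s f g'"
    unfolding add_1_left[of r s, symmetric]
    by (rule hom_mult[OF p.cup_hom_right[OF a.connecting_closed(1)[OF f]] gc gc'])
  have 2: "aug_right r s f (g \<otimes>\<^bsub>cochains G B s\<^esub> g') =
      aug_right r s f g \<otimes>\<^bsub>cochains G C (r + s + 1)\<^esub> aug_right r s f g'"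
    unfolding b.connecting_mult[OF g g'] add_1_right[of r s, symmetric]
    by (rule hom_mult[OF q.cup_hom_right[OF fc] b.connecting_closed(1)[OF g] b.connecting_closed(1)[OF g']])
  note cl = aug_left_closed[OF f gc] aug_left_closed[OF f gc'] aug_right_closed[OF fc g] aug_right_closed[OF fc g']
  show ?thesis
    unfolding aug_eq 1 2 C.cochains.int_pow_distrib[OF cl(3,4)]
    by (simp only: C.cochains.m_ac C.cochains.m_closed C.cochains.int_pow_closed cl)
qed

lemma cup_p_one_left:
  "g \<in> carrier (cochains G B s) \<Longrightarrow> cup G B p r s \<one>\<^bsub>cochains G A' r\<^esub> g = \<one>\<^bsub>cochains G C (r + s)\<^esub>"
  using hom_one[OF p.cup_hom_left a.A.cochains.is_group C.cochains.is_group] .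

lemma cup_q_one_right:
  "f \<in> carrier (cochains G A r) \<Longrightarrow> cup G B' q r s f \<one>\<^bsub>cochains G B' s\<^esub> = \<one>\<^bsub>cochains G C (r + s)\<^esub>"
  using hom_one[OF q.cup_hom_right b.A.cochains.is_group C.cochains.is_group] .

text \<open>The Leibniz rule with its first term gone, since the connecting cochain is a cocycle;
  its degree \<open>r + 1\<close> gives the sign. \<open>g\<close> may be any cochain of
  \<open>B\<close>, so the lemma also applies to a primitive of a coboundary.\<close>

lemma coboundary_aug_left:
  assumes f: "f \<in> a.cocycle_lifts r" and g: "g \<in> carrier (cochains G B s)"
  shows "coboundary G C (r + s + 1) (aug_left r s f g) =
    cup G B p (r + 1) (s + 1) (a.connecting r f) (coboundary G B s g)
      [^]\<^bsub>cochains G C (r + s + 1 + 1)\<^esub> (- ((-1) ^ r) :: int)"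
proof -
  note u = a.connecting_closed(1)[OF f]
  have du: "coboundary G A' (r + 1) (a.connecting r f) = \<one>\<^bsub>cochains G A' (r + 1 + 1)\<^esub>"
    using a.coboundary_connecting[OF f] by (simp only: add.assoc one_add_one)
  have i: "r + 1 + 1 + s = r + s + 1 + 1" by simp
  have cl: "cup G B p (r + 1) (s + 1) (a.connecting r f) (coboundary G B s g) \<in> carrier (cochains G C (r + s + 1 + 1))"
    using p.cup_closed[OF u b.B.coboundary_closed[OF g]] unfolding add_1_right add_1_left[of r s] .
  have "(-1) ^ (r + 1) = (- ((-1) ^ r) :: int)" by simp
  then show ?thesis
    using p.coboundary_cup[OF u g] cl
    unfolding du cup_p_one_left[OF g] i add_1_left[of r s]
    by (simp only: C.cochains.l_one C.cochains.int_pow_closed)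
qed

text \<open>Here the second Leibniz term vanishes, so no sign appears. \<open>f\<close> may be any
  cochain of \<open>A\<close>, again with primitives of coboundaries in view.\<close>

lemma coboundary_aug_right:
  assumes f: "f \<in> carrier (cochains G A r)" and g: "g \<in> b.cocycle_lifts s"
  shows "coboundary G C (r + s + 1) (aug_right r s f g) =
    cup G B' q (r + 1) (s + 1) (coboundary G A r f) (b.connecting s g)"
proof -
  note v = b.connecting_closed(1)[OF g]
  have dv: "coboundary G B' (s + 1) (b.connecting s g) = \<one>\<^bsub>cochains G B' (s + 1 + 1)\<^esub>"
    using b.coboundary_connecting[OF g] by (simp only: add.assoc one_add_one)
  have i: "r + (s + 1 + 1) = r + s + 1 + 1" by simp
  have cl: "cup G B' q (r + 1) (s + 1) (coboundary G A r f) (b.connecting s g) \<in> carrier (cochains G C (r + s + 1 + 1))"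
    using q.cup_closed[OF a.B.coboundary_closed[OF f] v] unfolding add_1_right add_1_left[of r s] .
  show ?thesis
    using q.coboundary_cup[OF f v] cl
    unfolding dv cup_q_one_right[OF f] i add_1_right[of r s]
    by (simp only: C.cochains.r_one C.cochains.int_pow_one)
qed

text \<open>Both coboundaries involve the cup product of d f and d g. By \<open>cup_coincide\<close>
  it is the same cochain whether d f is read in \<open>A'\<close> and paired by \<open>p\<close>, or
  d g is read in \<open>B'\<close> and paired by \<open>q\<close>.\<close>

lemma coboundary_aug_left_eq:
  assumes f: "f \<in> a.cocycle_lifts r" and g: "g \<in> b.cocycle_lifts s"
  shows "coboundary G C (r + s + 1) (aug_left r s f g) =
    coboundary G C (r + s + 1) (aug_right r s f g) [^]\<^bsub>cochains G C (r + s + 1 + 1)\<^esub> (- ((-1) ^ r) :: int)"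
proof -
  have "cup G B p (r + 1) (s + 1) (a.connecting r f) (coboundary G B s g) =
      cup G B' q (r + 1) (s + 1) (coboundary G A r f) (b.connecting s g)"
    using cup_coincide[OF a.connecting_closed(1)[OF f] b.connecting_closed(1)[OF g]]
    unfolding a.connecting_closed(2)[OF f] b.connecting_closed(2)[OF g] .
  then show ?thesis
    by (simp only: coboundary_aug_left[OF f lifts_cochain(2)[OF g]] coboundary_aug_right[OF lifts_cochain(1)[OF f] g])
qed

text \<open>With \<open>X\<close> the coboundary of the right term, the right term contributes
  \<open>X\<close> to the power \<open>e\<close> and the left term \<open>X\<close> to the power
  \<open>- e\<close>.\<close>

lemma aug_cocycle:
  assumes f: "f \<in> a.cocycle_lifts r" and g: "g \<in> b.cocycle_lifts s"
  shows "aug r s f g \<in> carrier (cocycles G C (r + s + 1))"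
proof -
  define e :: int where "e = (-1) ^ r"
  define X where "X = coboundary G C (r + s + 1) (aug_right r s f g)"
  note cl = aug_left_closed[OF f lifts_cochain(2)[OF g]] aug_right_closed[OF lifts_cochain(1)[OF f] g]
  have X: "X \<in> carrier (cochains G C (r + s + 1 + 1))"
    unfolding X_def by (rule C.coboundary_closed[OF cl(2)])
  have "coboundary G C (r + s + 1) (aug r s f g) =
      coboundary G C (r + s + 1) (aug_left r s f g) \<otimes>\<^bsub>cochains G C (r + s + 1 + 1)\<^esub>
      coboundary G C (r + s + 1) (aug_right r s f g [^]\<^bsub>cochains G C (r + s + 1)\<^esub> e)"
    unfolding aug_eq e_def
    by (rule hom_mult[OF C.coboundary_hom cl(1) C.cochains.int_pow_closed[OF cl(2)]])
  also have "coboundary G C (r + s + 1) (aug_right r s f g [^]\<^bsub>cochains G C (r + s + 1)\<^esub> e) =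
      X [^]\<^bsub>cochains G C (r + s + 1 + 1)\<^esub> e"
    unfolding X_def by (rule hom_int_pow[OF C.coboundary_hom cl(2) C.cochains.is_group C.cochains.is_group])
  also have "coboundary G C (r + s + 1) (aug_left r s f g) = X [^]\<^bsub>cochains G C (r + s + 1 + 1)\<^esub> (- e)"
    unfolding X_def e_def by (rule coboundary_aug_left_eq[OF f g])
  also have "X [^]\<^bsub>cochains G C (r + s + 1 + 1)\<^esub> (- e) \<otimes>\<^bsub>cochains G C (r + s + 1 + 1)\<^esub>
      X [^]\<^bsub>cochains G C (r + s + 1 + 1)\<^esub> e = \<one>\<^bsub>cochains G C (r + s + 1 + 1)\<^esub>"
    unfolding C.cochains.int_pow_neg[OF X] by (rule C.cochains.l_inv[OF C.cochains.int_pow_closed[OF X]])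
  finally show ?thesis
    unfolding C.cocycles_iff using aug_closed[OF f g] by (rule conjI[rotated])
qed

text \<open>When \<open>f\<close> comes from \<open>A'\<close>, the right term can be rewritten with
  \<open>p\<close>; the two terms are then the Leibniz expansion of a cup product that does
  exist.\<close>

lemma aug_image_left:
  assumes f': "f' \<in> carrier (cochains G A' r)" and g: "g \<in> b.cocycle_lifts s"
  shows "aug r s (cochain_map G r iA f') g \<in> coboundaries G C (r + s + 1)"
proof -
  note gc = lifts_cochain(2)[OF g]
  have "cup G B' q r (s + 1) (cochain_map G r iA f') (b.connecting s g) =
      cup G B p r (s + 1) f' (coboundary G B s g)"
    using cup_coincide[OF f' b.connecting_closed(1)[OF g]]
    unfolding b.connecting_closed(2)[OF g] by (rule sym)
  then have "aug r s (cochain_map G r iA f') g = coboundary G C (r + s) (cup G B p r s f' g)"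
    unfolding aug_eq p.coboundary_cup[OF f' gc] a.image_i_cocycle_lift(2)[OF f'] by (simp only:)
  then show ?thesis
    using p.cup_closed[OF f' gc] by simp
qed

text \<open>Mirror case: \<open>g\<close> comes from \<open>B'\<close>, and the left term is
  rewritten with \<open>q\<close>.\<close>

lemma aug_image_right:
  assumes f: "f \<in> a.cocycle_lifts r" and g': "g' \<in> carrier (cochains G B' s)"
  shows "aug r s f (cochain_map G s iB g') \<in> coboundaries G C (r + s + 1)"
proof -
  note fc = lifts_cochain(1)[OF f]
  have "cup G B p (r + 1) s (a.connecting r f) (cochain_map G s iB g') =
      cup G B' q (r + 1) s (coboundary G A r f) g'"
    using cup_coincide[OF a.connecting_closed(1)[OF f] g']
    unfolding a.connecting_closed(2)[OF f] .
  then have "aug r s f (cochain_map G s iB g') = coboundary G C (r + s) (cup G B' q r s f g')"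
    unfolding aug_eq q.coboundary_cup[OF fc g'] b.image_i_cocycle_lift(2)[OF g'] by (simp only:)
  then show ?thesis
    using q.cup_closed[OF fc g'] by simp
qed

text \<open>The signs are powers taken in the group of cochains, so the coboundaries are needed as a
  subgroup of that group and not only of the cocycles.\<close>

lemma coboundaries_int_pow:
  assumes "x \<in> coboundaries G C n"
  shows "x [^]\<^bsub>cochains G C n\<^esub> (k::int) \<in> coboundaries G C n"
proof -
  have S: "subgroup (coboundaries G C n) (cochains G C n)"
    using C.cochains.incl_subgroup[OF C.subgroup_cocycles] C.subgroup_coboundaries[of n]
    unfolding cocycles_def by simp
  from group.int_pow_closed[OF subgroup.subgroup_is_group[OF S C.cochains.is_group], of x k]
  show ?thesis
    using assms unfolding C.cochains.int_pow_consistent[OF S assms] by simp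
qed

text \<open>A coboundary is a cocycle, so its connecting cochain and with it the left term are
  trivial. If \<open>u\<close> is the coboundary of \<open>h\<close>, the right term is the
  coboundary of \<open>aug_right\<close> at \<open>h\<close>; in degree 0, \<open>u\<close> is the
  unit.\<close>

lemma aug_coboundary_left:
  assumes u: "u \<in> coboundaries G A r" and g: "g \<in> b.cocycle_lifts s"
  shows "aug r s u g \<in> coboundaries G C (r + s + 1)"
proof -
  note gc = lifts_cochain(2)[OF g] and v = b.connecting_closed(1)[OF g]
  have uz: "u \<in> carrier (cocycles G A r)"
    by (rule subsetD[OF a.B.coboundaries_subset u])
  have right: "aug_right r s u g \<in> coboundaries G C (r + s + 1)"
  proof (cases r)
    case 0
    have "cup G B' q r (s + 1) u (b.connecting s g) = \<one>\<^bsub>cochains G C (r + (s + 1))\<^esub>"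
      using hom_one[OF q.cup_hom_left[OF v] a.B.cochains.is_group C.cochains.is_group, of r] u 0 by simp
    then show ?thesis
      using subgroup.one_closed[OF C.subgroup_coboundaries[of "r + s + 1"]]
      unfolding C.cocycles_one add_1_right[of r s] by (simp only:)
  next
    case (Suc n)
    then obtain h where h: "h \<in> carrier (cochains G A n)" "u = coboundary G A n h"
      using u by auto
    have i: "n + (s + 1) + 1 = r + s + 1" "n + s + 1 = r + s" "n + 1 = r" using Suc by simp_all
    have "aug_right r s u g = coboundary G C (r + s) (aug_right n s h g)"
      using coboundary_aug_right[OF h(1) g] unfolding h(2)[symmetric] i by (rule sym)
    then show ?thesis
      using aug_right_closed[OF h(1) g] unfolding i by simp
  qed
  have "aug_left r s u g = \<one>\<^bsub>cochains G C (r + s + 1)\<^esub>"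
    using cup_p_one_left[OF gc, of "r + 1"] unfolding a.cocycle_lift_cocycle(2)[OF uz] add_1_left[of r s] .
  moreover have "aug_right r s u g [^]\<^bsub>cochains G C (r + s + 1)\<^esub> k \<in> carrier (cochains G C (r + s + 1))" for k :: int
    by (rule C.cochains.int_pow_closed[OF aug_right_closed[OF lifts_cochain(1)[OF a.cocycle_lift_cocycle(1)[OF uz]] g]])
  ultimately have "aug r s u g = aug_right r s u g [^]\<^bsub>cochains G C (r + s + 1)\<^esub> ((-1) ^ r :: int)"
    unfolding aug_eq by (simp only: C.cochains.l_one)
  then show ?thesis
    using coboundaries_int_pow[OF right] by (simp only:)
qed

text \<open>Mirror case through \<open>coboundary_aug_left\<close>, which exhibits the left term as
  a coboundary only up to a sign.\<close>

lemma aug_coboundary_right: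
  assumes f: "f \<in> a.cocycle_lifts r" and u: "u \<in> coboundaries G B s"
  shows "aug r s f u \<in> coboundaries G C (r + s + 1)"
proof -
  note fc = lifts_cochain(1)[OF f] and v = a.connecting_closed(1)[OF f]
  have uz: "u \<in> carrier (cocycles G B s)"
    by (rule subsetD[OF b.B.coboundaries_subset u])
  have left: "aug_left r s f u \<in> coboundaries G C (r + s + 1)"
  proof (cases s)
    case 0
    have "cup G B p (r + 1) s (a.connecting r f) u = \<one>\<^bsub>cochains G C (r + 1 + s)\<^esub>"
      using hom_one[OF p.cup_hom_right[OF v] b.B.cochains.is_group C.cochains.is_group, of s] u 0 by simp
    then show ?thesis
      using subgroup.one_closed[OF C.subgroup_coboundaries[of "r + s + 1"]]
      unfolding C.cocycles_one add_1_left[of r s] by (simp only:)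
  next
    case (Suc n)
    then obtain h where h: "h \<in> carrier (cochains G B n)" "u = coboundary G B n h"
      using u by auto
    have i: "r + n + 1 = r + s" "n + 1 = s" using Suc by simp_all
    define e :: int where "e = (-1) ^ r"
    have e: "- e * - e = 1" unfolding e_def by (simp flip: power_mult_distrib)
    note ul = aug_left_closed[OF f lifts_cochain(2)[OF b.cocycle_lift_cocycle(1)[OF uz]]]
    have "coboundary G C (r + n + 1) (aug_left r n f h) = aug_left r s f u [^]\<^bsub>cochains G C (r + s + 1)\<^esub> (- e)"
      using coboundary_aug_left[OF f h(1)] unfolding h(2)[symmetric] i e_def .
    moreover have "coboundary G C (r + n + 1) (aug_left r n f h) \<in> coboundaries G C (r + s + 1)"
      using aug_left_closed[OF f h(1)] unfolding i by simp
    \<comment> \<open>The sign \<open>- e\<close> is its own inverse: raising to it a second time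
      recovers the left term itself.\<close>
    ultimately have "(aug_left r s f u [^]\<^bsub>cochains G C (r + s + 1)\<^esub> (- e)) [^]\<^bsub>cochains G C (r + s + 1)\<^esub> (- e)
        \<in> coboundaries G C (r + s + 1)"
      using coboundaries_int_pow by (simp only:)
    then show ?thesis
      unfolding C.cochains.int_pow_pow[OF ul] e C.cochains.int_pow_1[OF ul] .
  qed
  have "aug_right r s f u = \<one>\<^bsub>cochains G C (r + s + 1)\<^esub>"
    using cup_q_one_right[OF fc, of "s + 1"] unfolding b.cocycle_lift_cocycle(2)[OF uz] add_1_right[of r s] .
  moreover have "aug_left r s f u \<in> carrier (cochains G C (r + s + 1))"
    by (rule aug_left_closed[OF f lifts_cochain(2)[OF b.cocycle_lift_cocycle(1)[OF uz]]])
  ultimately have "aug r s f u = aug_left r s f u"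
    unfolding aug_eq by (simp only: C.cochains.r_one C.cochains.int_pow_one)
  then show ?thesis
    using left by (simp only:)
qed

lemma coboundaries_mult:
  "\<lbrakk>x \<in> coboundaries G C n; y \<in> coboundaries G C n\<rbrakk> \<Longrightarrow> x \<otimes>\<^bsub>cochains G C n\<^esub> y \<in> coboundaries G C n"
  using subgroup.m_closed[OF C.subgroup_coboundaries] unfolding C.cocycles_mult .

lemma aug_trivial_left:
  assumes f: "f \<in> a.cocycle_lifts r" "cochain_map G r jA f \<in> coboundaries G A'' r"
    and g: "g \<in> b.cocycle_lifts s"
  shows "aug r s f g \<in> coboundaries G C (r + s + 1)"
proof -
  obtain f' u where f': "f' \<in> carrier (cochains G A' r)" and u: "u \<in> coboundaries G A r"
    and eq: "f = cochain_map G r iA f' \<otimes>\<^bsub>cochains G A r\<^esub> u"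
    using a.coboundary_lift_decomposition[OF lifts_cochain(1)[OF f(1)] f(2)] .
  show ?thesis
    unfolding eq aug_mult_left[OF a.image_i_cocycle_lift(1)[OF f']
        a.cocycle_lift_cocycle(1)[OF subsetD[OF a.B.coboundaries_subset u]] g]
    by (rule coboundaries_mult[OF aug_image_left[OF f' g] aug_coboundary_left[OF u g]])
qed

lemma aug_trivial_right:
  assumes f: "f \<in> a.cocycle_lifts r" and g: "g \<in> b.cocycle_lifts s" "cochain_map G s jB g \<in> coboundaries G B'' s"
  shows "aug r s f g \<in> coboundaries G C (r + s + 1)"
proof -
  obtain g' u where g': "g' \<in> carrier (cochains G B' s)" and u: "u \<in> coboundaries G B s"
    and eq: "g = cochain_map G s iB g' \<otimes>\<^bsub>cochains G B s\<^esub> u"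
    using b.coboundary_lift_decomposition[OF lifts_cochain(2)[OF g(1)] g(2)] .
  show ?thesis
    unfolding eq aug_mult_right[OF f b.image_i_cocycle_lift(1)[OF g']
        b.cocycle_lift_cocycle(1)[OF subsetD[OF b.B.coboundaries_subset u]]]
    by (rule coboundaries_mult[OF aug_image_right[OF f g'] aug_coboundary_right[OF f u]])
qed

abbreviation aug_class :: "nat \<Rightarrow> nat \<Rightarrow> ((nat \<Rightarrow> 'g) \<Rightarrow> 'a) \<Rightarrow> ((nat \<Rightarrow> 'g) \<Rightarrow> 'b) \<Rightarrow> ((nat \<Rightarrow> 'g) \<Rightarrow> 'c) set" where
  "aug_class r s f g \<equiv> coh_class G C (r + s + 1) (aug r s f g)"

end

section \<open>Lifts of cohomology classes\<close>

context profinite_short_exact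
begin

text \<open>Reduces independence of the lift to a vanishing statement: by additivity, replacing
  \<open>g\<close> by \<open>f\<close> changes the product by the contribution of \<open>u\<close>,
  whose image is a coboundary.\<close>

lemma lift_quotient:
  assumes f: "f \<in> cocycle_lifts r" and g: "g \<in> cocycle_lifts r"
    and eq: "coh_class G C r (cochain_map G r j f) = coh_class G C r (cochain_map G r j g)"
  obtains u where "u \<in> cocycle_lifts r" "cochain_map G r j u \<in> coboundaries G C r"
    "f = u \<otimes>\<^bsub>cochains G B r\<^esub> g"
proof (rule that)
  note fc = cocycle_lifts_cochain[OF f] and gc = cocycle_lifts_cochain[OF g]
  let ?u = "f \<otimes>\<^bsub>cochains G B r\<^esub> inv\<^bsub>cochains G B r\<^esub> g"
  show "?u \<in> cocycle_lifts r"
    by (rule subgroup.m_closed[OF subgroup_cocycle_lifts f subgroup.m_inv_closed[OF subgroup_cocycle_lifts g]])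
  have z: "cochain_map G r j f \<in> carrier (cocycles G C r)" "cochain_map G r j g \<in> carrier (cocycles G C r)"
    using f g unfolding cocycle_lifts_def by blast+
  have "cochain_map G r j ?u = cochain_map G r j f \<otimes>\<^bsub>cochains G C r\<^esub> inv\<^bsub>cochains G C r\<^esub> cochain_map G r j g"
    unfolding hom_mult[OF j.cochain_map_hom fc B.cochains.inv_closed[OF gc]]
      group_hom.hom_inv[OF j.cochain_map_group_hom gc] ..
  then show "cochain_map G r j ?u \<in> coboundaries G C r"
    using eq unfolding C.coh_class_eq_iff[OF z] by (simp only:)
  show "f = ?u \<otimes>\<^bsub>cochains G B r\<^esub> g"
    using fc gc by (simp only: B.cochains.m_assoc B.cochains.inv_closed B.cochains.l_inv B.cochains.r_one)
qed

lemma lift_of_class: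
  assumes "\<alpha> \<in> carrier (cohomology G C r)"
  obtains f where "f \<in> cocycle_lifts r" "cochain_map G r j f \<in> \<alpha>"
proof -
  obtain u where u: "u \<in> \<alpha>" "u \<in> carrier (cocycles G C r)" "\<alpha> = coh_class G C r u"
    using C.cohomology_nonempty[OF assms] .
  obtain f where f: "f \<in> cocycle_lifts r" "cochain_map G r j f = u"
    using cocycle_lift_exists[OF u(2)] .
  show ?thesis
    using that[OF f(1)] u(1) unfolding f(2) by blast
qed

text \<open>Carries additivity from cochains over to classes.\<close>

lemma lift_of_mult:
  assumes \<alpha>: "\<alpha> \<in> carrier (cohomology G C r)" "\<beta> \<in> carrier (cohomology G C r)"
    and f: "f \<in> cocycle_lifts r" "cochain_map G r j f \<in> \<alpha>"
    and g: "g \<in> cocycle_lifts r" "cochain_map G r j g \<in> \<beta>"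
  shows "f \<otimes>\<^bsub>cochains G B r\<^esub> g \<in> cocycle_lifts r"
    and "cochain_map G r j (f \<otimes>\<^bsub>cochains G B r\<^esub> g) \<in> \<alpha> \<otimes>\<^bsub>cohomology G C r\<^esub> \<beta>"
proof -
  show fg: "f \<otimes>\<^bsub>cochains G B r\<^esub> g \<in> cocycle_lifts r"
    by (rule subgroup.m_closed[OF subgroup_cocycle_lifts f(1) g(1)])
  note u = C.mem_cohomology[OF \<alpha>(1) f(2)] and v = C.mem_cohomology[OF \<alpha>(2) g(2)]
  have "\<alpha> \<otimes>\<^bsub>cohomology G C r\<^esub> \<beta> =
      coh_class G C r (cochain_map G r j (f \<otimes>\<^bsub>cochains G B r\<^esub> g))"
    unfolding hom_mult[OF j.cochain_map_hom cocycle_lifts_cochain[OF f(1)] cocycle_lifts_cochain[OF g(1)]]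
      C.coh_class_mult[OF u(1) v(1)] u(2) v(2) ..
  then show "cochain_map G r j (f \<otimes>\<^bsub>cochains G B r\<^esub> g) \<in> \<alpha> \<otimes>\<^bsub>cohomology G C r\<^esub> \<beta>"
    using fg unfolding cocycle_lifts_def by (simp only: C.mem_coh_class_iff mem_Collect_eq simp_thms)
qed

end

section \<open>The augmented cup product on classes\<close>

context profinite_tate_product
begin

lemma aug_class_cong_left:
  assumes f: "f \<in> a.cocycle_lifts r" "f' \<in> a.cocycle_lifts r" and g: "g \<in> b.cocycle_lifts s"
    and eq: "coh_class G A'' r (cochain_map G r jA f) = coh_class G A'' r (cochain_map G r jA f')"
  shows "aug_class r s f g = aug_class r s f' g"
proof -
  obtain u where u: "u \<in> a.cocycle_lifts r" "cochain_map G r jA u \<in> coboundaries G A'' r"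
    and fu: "f = u \<otimes>\<^bsub>cochains G A r\<^esub> f'"
    using a.lift_quotient[OF f eq] .
  have "aug_class r s u g = \<one>\<^bsub>cohomology G C (r + s + 1)\<^esub>"
    unfolding C.coh_class_eq_one_iff[OF aug_cocycle[OF u(1) g]] by (rule aug_trivial_left[OF u g])
  then show ?thesis
    unfolding fu aug_mult_left[OF u(1) f(2) g] C.coh_class_mult[OF aug_cocycle[OF u(1) g] aug_cocycle[OF f(2) g]]
    using C.cohomology.l_one[OF C.coh_class_closed[OF aug_cocycle[OF f(2) g]]] by (simp only:)
qed

lemma aug_class_cong_right:
  assumes f: "f \<in> a.cocycle_lifts r" and g: "g \<in> b.cocycle_lifts s" "g' \<in> b.cocycle_lifts s"
    and eq: "coh_class G B'' s (cochain_map G s jB g) = coh_class G B'' s (cochain_map G s jB g')"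
  shows "aug_class r s f g = aug_class r s f g'"
proof -
  obtain u where u: "u \<in> b.cocycle_lifts s" "cochain_map G s jB u \<in> coboundaries G B'' s"
    and gu: "g = u \<otimes>\<^bsub>cochains G B s\<^esub> g'"
    using b.lift_quotient[OF g eq] .
  have "aug_class r s f u = \<one>\<^bsub>cohomology G C (r + s + 1)\<^esub>"
    unfolding C.coh_class_eq_one_iff[OF aug_cocycle[OF f u(1)]] by (rule aug_trivial_right[OF f u])
  then show ?thesis
    unfolding gu aug_mult_right[OF f u(1) g(2)] C.coh_class_mult[OF aug_cocycle[OF f u(1)] aug_cocycle[OF f g(2)]]
    using C.cohomology.l_one[OF C.coh_class_closed[OF aug_cocycle[OF f g(2)]]] by (simp only:)
qed

abbreviation aug_product :: "nat \<Rightarrow> nat \<Rightarrow> ((nat \<Rightarrow> 'g) \<Rightarrow> 'a2) set \<Rightarrow> ((nat \<Rightarrow> 'g) \<Rightarrow> 'b2) set \<Rightarrow>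
    ((nat \<Rightarrow> 'g) \<Rightarrow> 'c) set" where
  "aug_product r s \<equiv> aug_cup G A' iA A jA B' iB B jB C p q r s"

text \<open>The set under \<open>the_elem\<close> is a singleton, since \<open>f\<close> and then
  \<open>g\<close> can be exchanged without changing the class. From here on any convenient lifts
  compute the product.\<close>

lemma aug_product_eq:
  assumes \<alpha>: "\<alpha> \<in> carrier (cohomology G A'' r)" and \<beta>: "\<beta> \<in> carrier (cohomology G B'' s)"
    and f: "f \<in> carrier (cochains G A r)" "cochain_map G r jA f \<in> \<alpha>"
    and g: "g \<in> carrier (cochains G B s)" "cochain_map G s jB g \<in> \<beta>"
  shows "aug_product r s \<alpha> \<beta> = aug_class r s f g"
proof -
  have la: "h \<in> a.cocycle_lifts r" "coh_class G A'' r (cochain_map G r jA h) = \<alpha>"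
    if "h \<in> carrier (cochains G A r)" "cochain_map G r jA h \<in> \<alpha>" for h
    using that a.C.mem_cohomology[OF \<alpha> that(2)] unfolding a.cocycle_lifts_def by blast+
  have lb: "h \<in> b.cocycle_lifts s" "coh_class G B'' s (cochain_map G s jB h) = \<beta>"
    if "h \<in> carrier (cochains G B s)" "cochain_map G s jB h \<in> \<beta>" for h
    using that b.C.mem_cohomology[OF \<beta> that(2)] unfolding b.cocycle_lifts_def by blast+
  have eq: "aug_class r s f' g' = aug_class r s f g"
    if "f' \<in> carrier (cochains G A r)" "g' \<in> carrier (cochains G B s)"
      "cochain_map G r jA f' \<in> \<alpha>" "cochain_map G s jB g' \<in> \<beta>" for f' g'
  proof -
    note f' = la[OF that(1,3)] and g' = lb[OF that(2,4)]
    have "aug_class r s f' g' = aug_class r s f g'"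
      by (rule aug_class_cong_left[OF f'(1) la(1)[OF f] g'(1)]) (simp only: f'(2) la(2)[OF f])
    also have "\<dots> = aug_class r s f g"
      by (rule aug_class_cong_right[OF la(1)[OF f] g'(1) lb(1)[OF g]]) (simp only: g'(2) lb(2)[OF g])
    finally show ?thesis .
  qed
  have "{aug_class r s f' g' | f' g'.
       f' \<in> carrier (cochains G A r) \<and> g' \<in> carrier (cochains G B s) \<and>
       cochain_map G r jA f' \<in> \<alpha> \<and> cochain_map G s jB g' \<in> \<beta>} = {aug_class r s f g}"
  proof (intro equalityI subsetI)
    fix x assume "x \<in> {aug_class r s f g}"
    then show "x \<in> {aug_class r s f' g' | f' g'.
       f' \<in> carrier (cochains G A r) \<and> g' \<in> carrier (cochains G B s) \<and>
       cochain_map G r jA f' \<in> \<alpha> \<and> cochain_map G s jB g' \<in> \<beta>}"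
      using f g by blast
  qed (use eq in blast)
  then show ?thesis
    unfolding aug_cup_def by (simp only: the_elem_eq)
qed

lemma aug_product_closed:
  assumes \<alpha>: "\<alpha> \<in> carrier (cohomology G A'' r)" and \<beta>: "\<beta> \<in> carrier (cohomology G B'' s)"
  shows "aug_product r s \<alpha> \<beta> \<in> carrier (cohomology G C (r + s + 1))"
proof -
  obtain f where f: "f \<in> a.cocycle_lifts r" "cochain_map G r jA f \<in> \<alpha>"
    using a.lift_of_class[OF \<alpha>] .
  obtain g where g: "g \<in> b.cocycle_lifts s" "cochain_map G s jB g \<in> \<beta>"
    using b.lift_of_class[OF \<beta>] .
  show ?thesis
    unfolding aug_product_eq[OF \<alpha> \<beta> lifts_cochain(1)[OF f(1)] f(2) lifts_cochain(2)[OF g(1)] g(2)]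
    by (rule C.coh_class_closed[OF aug_cocycle[OF f(1) g(1)]])
qed

lemma aug_product_mult_left:
  assumes \<alpha>: "\<alpha> \<in> carrier (cohomology G A'' r)" "\<alpha>' \<in> carrier (cohomology G A'' r)"
    and \<beta>: "\<beta> \<in> carrier (cohomology G B'' s)"
  shows "aug_product r s (\<alpha> \<otimes>\<^bsub>cohomology G A'' r\<^esub> \<alpha>') \<beta> =
    aug_product r s \<alpha> \<beta> \<otimes>\<^bsub>cohomology G C (r + s + 1)\<^esub> aug_product r s \<alpha>' \<beta>"
proof -
  obtain f where f: "f \<in> a.cocycle_lifts r" "cochain_map G r jA f \<in> \<alpha>"
    using a.lift_of_class[OF \<alpha>(1)] .
  obtain f' where f': "f' \<in> a.cocycle_lifts r" "cochain_map G r jA f' \<in> \<alpha>'"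
    using a.lift_of_class[OF \<alpha>(2)] .
  obtain g where g: "g \<in> b.cocycle_lifts s" "cochain_map G s jB g \<in> \<beta>"
    using b.lift_of_class[OF \<beta>] .
  note gc = lifts_cochain(2)[OF g(1)] g(2)
  show ?thesis
    unfolding aug_product_eq[OF \<alpha>(1) \<beta> lifts_cochain(1)[OF f(1)] f(2) gc]
      aug_product_eq[OF \<alpha>(2) \<beta> lifts_cochain(1)[OF f'(1)] f'(2) gc]
      aug_product_eq[OF a.C.cohomology.m_closed[OF \<alpha>] \<beta>
        lifts_cochain(1)[OF a.lift_of_mult(1)[OF \<alpha> f f']] a.lift_of_mult(2)[OF \<alpha> f f'] gc]
      aug_mult_left[OF f(1) f'(1) g(1)]
    by (rule C.coh_class_mult[OF aug_cocycle[OF f(1) g(1)] aug_cocycle[OF f'(1) g(1)]])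
qed

lemma aug_product_mult_right:
  assumes \<alpha>: "\<alpha> \<in> carrier (cohomology G A'' r)"
    and \<beta>: "\<beta> \<in> carrier (cohomology G B'' s)" "\<beta>' \<in> carrier (cohomology G B'' s)"
  shows "aug_product r s \<alpha> (\<beta> \<otimes>\<^bsub>cohomology G B'' s\<^esub> \<beta>') =
    aug_product r s \<alpha> \<beta> \<otimes>\<^bsub>cohomology G C (r + s + 1)\<^esub> aug_product r s \<alpha> \<beta>'"
proof -
  obtain f where f: "f \<in> a.cocycle_lifts r" "cochain_map G r jA f \<in> \<alpha>"
    using a.lift_of_class[OF \<alpha>] .
  obtain g where g: "g \<in> b.cocycle_lifts s" "cochain_map G s jB g \<in> \<beta>"
    using b.lift_of_class[OF \<beta>(1)] .
  obtain g' where g': "g' \<in> b.cocycle_lifts s" "cochain_map G s jB g' \<in> \<beta>'"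
    using b.lift_of_class[OF \<beta>(2)] .
  note fc = lifts_cochain(1)[OF f(1)] f(2)
  show ?thesis
    unfolding aug_product_eq[OF \<alpha> \<beta>(1) fc lifts_cochain(2)[OF g(1)] g(2)]
      aug_product_eq[OF \<alpha> \<beta>(2) fc lifts_cochain(2)[OF g'(1)] g'(2)]
      aug_product_eq[OF \<alpha> b.C.cohomology.m_closed[OF \<beta>] fc
        lifts_cochain(2)[OF b.lift_of_mult(1)[OF \<beta> g g']] b.lift_of_mult(2)[OF \<beta> g g']]
      aug_mult_right[OF f(1) g(1) g'(1)]
    by (rule C.coh_class_mult[OF aug_cocycle[OF f(1) g(1)] aug_cocycle[OF f(1) g'(1)]])
qed

text \<open>Cocycle lifts have trivial connecting cochains, so each term of the augmented cochain is
  a cup product with a unit factor.\<close>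

lemma aug_product_cocycles:
  assumes f: "f \<in> carrier (cocycles G A r)" and g: "g \<in> carrier (cocycles G B s)"
  shows "aug_product r s (coh_class G A'' r (cochain_map G r jA f)) (coh_class G B'' s (cochain_map G s jB g)) =
    \<one>\<^bsub>cohomology G C (r + s + 1)\<^esub>"
proof -
  note lf = a.cocycle_lift_cocycle[OF f] and lg = b.cocycle_lift_cocycle[OF g]
  note z = a.j.cochain_map_cocycle[OF f] b.j.cochain_map_cocycle[OF g]
  have "aug_left r s f g = \<one>\<^bsub>cochains G C (r + s + 1)\<^esub>"
    using cup_p_one_left[OF lifts_cochain(2)[OF lg(1)], of "r + 1"] unfolding lf(2) add_1_left[of r s] .
  moreover have "aug_right r s f g = \<one>\<^bsub>cochains G C (r + s + 1)\<^esub>"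
    using cup_q_one_right[OF lifts_cochain(1)[OF lf(1)], of "s + 1"] unfolding lg(2) add_1_right[of r s] .
  ultimately have "aug r s f g = \<one>\<^bsub>cochains G C (r + s + 1)\<^esub>"
    unfolding aug_eq by (simp only: C.cochains.int_pow_one C.cochains.l_one C.cochains.one_closed)
  then have "aug r s f g \<in> coboundaries G C (r + s + 1)"
    using subgroup.one_closed[OF C.subgroup_coboundaries[of "r + s + 1"]]
    unfolding C.cocycles_one by (simp only:)
  moreover have "cochain_map G r jA f \<in> coh_class G A'' r (cochain_map G r jA f)"
    "cochain_map G s jB g \<in> coh_class G B'' s (cochain_map G s jB g)"
    using z by (simp_all only: a.C.mem_coh_class_iff b.C.mem_coh_class_iff simp_thms)
  ultimately show ?thesis
    using aug_product_eq[OF a.C.coh_class_closed[OF z(1)] b.C.coh_class_closed[OF z(2)]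
        lifts_cochain(1)[OF lf(1)] _ lifts_cochain(2)[OF lg(1)]]
      C.coh_class_eq_one_iff[OF aug_cocycle[OF lf(1) lg(1)]] by (simp only:)
qed

end

section \<open>Kernel classes and the induced pairing\<close>

lemma kernel_class_lifts_to_cocycle:
  fixes G :: "'g tgroup"
  assumes G: "profinite_group G"
    and B: "short_exact G B \<iota> D \<pi> E" and B'': "short_exact G B'' \<phi> D'' \<psi> E"
    and jB: "jB \<in> gmod_hom G B B''" and \<delta>: "\<delta> \<in> gmod_hom G D D''" "\<delta> ` carrier D = carrier D''"
    and left_square: "\<forall>b\<in>carrier B. \<delta> (\<iota> b) = \<phi> (jB b)"
    and right_square: "\<forall>d\<in>carrier D. \<psi> (\<delta> d) = \<pi> d"
    and s: "s \<ge> 1"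
    and \<beta>: "\<beta> \<in> kernel (cohomology G B'' s) (cohomology G D'' s) (coh_map G D'' s \<phi>)"
  obtains g where "g \<in> carrier (cocycles G B s)" "\<beta> = coh_class G B'' s (cochain_map G s jB g)"
proof -
  interpret b: profinite_short_exact G B \<iota> D \<pi> E
    by (intro profinite_short_exact.intro profinite_short_exact_axioms.intro G B)
  interpret b'': profinite_short_exact G B'' \<phi> D'' \<psi> E
    by (intro profinite_short_exact.intro profinite_short_exact_axioms.intro G B'')
  interpret \<delta>: profinite_gmod_hom G D D'' \<delta>
    by unfold_locales (rule \<delta>(1))
  interpret jB: profinite_gmod_hom G B B'' jB
    by unfold_locales (rule jB)
  \<comment> \<open>\<open>n\<close> is the degree of the primitive \<open>e''\<close>, which exists
    because \<open>s \<ge> 1\<close>; in degree 0 the coboundaries are not images of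
    cochains.\<close>
  obtain n where n: "s = n + 1" using s by (metis add.commute le_Suc_ex)
  have \<beta>c: "\<beta> \<in> carrier (cohomology G B'' s)" "coh_map G D'' s \<phi> \<beta> = \<one>\<^bsub>cohomology G D'' s\<^esub>"
    using \<beta> unfolding kernel_def by blast+
  obtain v where v: "v \<in> carrier (cocycles G B'' s)" "\<beta> = coh_class G B'' s v"
    using b''.A.cohomology_nonempty[OF \<beta>c(1)] .
  have vc: "v \<in> carrier (cochains G B'' s)"
    using v(1) unfolding b''.A.cocycles_iff by blast
  have "cochain_map G s \<phi> v \<in> coboundaries G D'' s"
    using \<beta>c(2) unfolding v(2) b''.i.coh_map_coh_class[OF v(1)]
      b''.B.coh_class_eq_one_iff[OF b''.i.cochain_map_cocycle[OF v(1)]] .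
  then obtain e'' where e'': "e'' \<in> carrier (cochains G D'' n)" "cochain_map G s \<phi> v = coboundary G D'' n e''"
    unfolding n by auto
  obtain e where e: "e \<in> carrier (cochains G D n)" "cochain_map G n \<delta> e = e''"
    using cochain_map_lift[OF \<delta>(2) e''(1)] .
  note de = b.B.coboundary_closed[OF e(1), folded n]
  have \<delta>de: "cochain_map G s \<delta> (coboundary G D n e) = cochain_map G s \<phi> v"
    unfolding e''(2) unfolding e(2)[symmetric] \<delta>.coboundary_cochain_map[OF e(1)] unfolding n ..
  \<comment> \<open>Both rows end in the same \<open>E\<close>: by the right square,
    \<open>\<pi>\<close> of the coboundary of \<open>e\<close> equals \<open>\<psi>\<close> of
    \<open>\<phi> v\<close>, which is trivial by exactness of the lower row.\<close>
  have "cochain_map G s \<pi> (coboundary G D n e) = cochain_map G s \<psi> (cochain_map G s \<delta> (coboundary G D n e))"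
  proof (rule cochain_eqI[where A = E])
    fix x assume x: "x \<in> tuples G s"
    then show "cochain_map G s \<pi> (coboundary G D n e) x =
        cochain_map G s \<psi> (cochain_map G s \<delta> (coboundary G D n e)) x"
      using bspec[OF right_square cochain_closed[OF de x]] by (simp only: cochain_map_apply)
  qed (rule b.j.cochain_map_in_cochains[OF de]
      b''.j.cochain_map_in_cochains[OF \<delta>.cochain_map_in_cochains[OF de]])+
  also have "\<dots> = \<one>\<^bsub>cochains G E s\<^esub>"
    unfolding \<delta>de by (rule b''.j_cochain_map_i[OF vc])
  finally have \<pi>de: "cochain_map G s \<pi> (coboundary G D n e) = \<one>\<^bsub>cochains G E s\<^esub>" .
  define g where "g = cochain_pullback G B s \<iota> (coboundary G D n e)"
  note g = b.pullback_closed[OF de \<pi>de, folded g_def]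
  \<comment> \<open>\<open>\<iota>\<close> is injective on cochains, so d d = 0 in \<open>D\<close>
    makes \<open>g\<close> a cocycle of \<open>B\<close>.\<close>
  have "cochain_map G (s + 1) \<iota> (coboundary G B s g) = coboundary G D s (coboundary G D n e)"
    unfolding b.i.coboundary_cochain_map[OF g(1), symmetric] g(2) ..
  also have "\<dots> = \<one>\<^bsub>cochains G D (s + 1)\<^esub>"
    using b.B.coboundary_coboundary[OF e(1)] unfolding n by simp
  also have "\<dots> = cochain_map G (s + 1) \<iota> \<one>\<^bsub>cochains G B (s + 1)\<^esub>"
    by (rule b.i.cochain_map_one[symmetric])
  finally have "coboundary G B s g = \<one>\<^bsub>cochains G B (s + 1)\<^esub>"
    by (rule b.cochain_map_i_cancel[OF b.A.coboundary_closed[OF g(1)] b.A.cochains_one_closed])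
  then have gz: "g \<in> carrier (cocycles G B s)"
    unfolding b.A.cocycles_iff using g(1) by blast
  \<comment> \<open>By the left square \<open>jB g\<close> and \<open>v\<close> have the same image
    under \<open>\<phi>\<close>, which is injective on cochains; thus \<open>g\<close> lifts the
    cocycle \<open>v\<close> itself and not just its class.\<close>
  have "cochain_map G s \<phi> (cochain_map G s jB g) = cochain_map G s \<delta> (cochain_map G s \<iota> g)"
    by (rule cochain_map_cochain_map[OF g(1)]) (rule bspec[OF left_square, THEN sym])
  also have "\<dots> = cochain_map G s \<phi> v"
    unfolding g(2) by (rule \<delta>de)
  finally have "cochain_map G s jB g = v"
    by (rule b''.cochain_map_i_cancel[OF jB.cochain_map_in_cochains[OF g(1)] vc])
  then show ?thesis
    using that[OF gz] v(2) by blast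
qed

text \<open>The homomorphism theorem in the second variable: for \<open>a\<close> in
  \<open>S\<close> the map \<open>p a\<close> kills the kernel of \<open>h\<close>, so it depends
  only on the image under \<open>h\<close>.\<close>

lemma bilinear_pairing_factors:
  assumes p: "bilinear_pairing H K L p" and h: "h \<in> hom K K'" and "group K" "group K'" "group L"
    and S: "S \<subseteq> carrier H"
    and trivial: "\<And>a b. \<lbrakk>a \<in> S; b \<in> kernel K K' h\<rbrakk> \<Longrightarrow> p a b = \<one>\<^bsub>L\<^esub>"
  shows "\<exists>\<Phi>. bilinear_pairing (H\<lparr>carrier := S\<rparr>) (K'\<lparr>carrier := h ` carrier K\<rparr>) L \<Phi> \<and>
    (\<forall>a\<in>S. \<forall>b\<in>carrier K. \<Phi> a (h b) = p a b)"
proof -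
  interpret K: group K by fact
  interpret L: group L by fact
  interpret h: group_hom K K' h
    by (simp add: group_hom_def group_hom_axioms_def assms)
  have pr: "p a \<in> hom K L" if "a \<in> S" for a
    using p S that unfolding bilinear_pairing_def by blast
  have pl: "(\<lambda>a. p a b) \<in> hom H L" if "b \<in> carrier K" for b
    using p that unfolding bilinear_pairing_def by blast
  have eq: "p a b = p a b'" if "a \<in> S" "b \<in> carrier K" "b' \<in> carrier K" "h b = h b'" for a b b'
  proof -
    have k: "b \<otimes>\<^bsub>K\<^esub> inv\<^bsub>K\<^esub> b' \<in> kernel K K' h"
      using that by (simp add: kernel_def)
    have "p a b = p a (b \<otimes>\<^bsub>K\<^esub> inv\<^bsub>K\<^esub> b' \<otimes>\<^bsub>K\<^esub> b')"
      using that by (simp add: K.m_assoc)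
    also have "\<dots> = p a (b \<otimes>\<^bsub>K\<^esub> inv\<^bsub>K\<^esub> b') \<otimes>\<^bsub>L\<^esub> p a b'"
      using that by (intro hom_mult[OF pr]) auto
    also have "\<dots> = p a b'"
      using trivial[OF that(1) k] hom_in_carrier[OF pr[OF that(1)] that(3)] by simp
    finally show ?thesis .
  qed
  define \<Phi> where "\<Phi> = (\<lambda>a x. p a (inv_into (carrier K) h x))"
  have \<Phi>: "\<Phi> a (h b) = p a b" if "a \<in> S" "b \<in> carrier K" for a b
    unfolding \<Phi>_def
    by (rule eq[OF that(1) _ that(2)]) (use that in \<open>auto intro: inv_into_into f_inv_into_f\<close>)
  have "\<Phi> a \<in> hom (K'\<lparr>carrier := h ` carrier K\<rparr>) L" if a: "a \<in> S" for a
  proof (rule homI)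
    fix x assume "x \<in> carrier (K'\<lparr>carrier := h ` carrier K\<rparr>)"
    then show "\<Phi> a x \<in> carrier L"
      using \<Phi>[OF a] hom_in_carrier[OF pr[OF a]] by auto
  next
    fix x y assume "x \<in> carrier (K'\<lparr>carrier := h ` carrier K\<rparr>)" "y \<in> carrier (K'\<lparr>carrier := h ` carrier K\<rparr>)"
    then obtain b b' where b: "b \<in> carrier K" "x = h b" "b' \<in> carrier K" "y = h b'"
      by auto
    have "\<Phi> a (x \<otimes>\<^bsub>K'\<lparr>carrier := h ` carrier K\<rparr>\<^esub> y) = \<Phi> a (h (b \<otimes>\<^bsub>K\<^esub> b'))"
      using b by simp
    also have "\<dots> = p a (b \<otimes>\<^bsub>K\<^esub> b')"
      by (rule \<Phi>[OF a K.m_closed[OF b(1,3)]])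
    also have "\<dots> = \<Phi> a x \<otimes>\<^bsub>L\<^esub> \<Phi> a y"
      unfolding b(2,4) \<Phi>[OF a b(1)] \<Phi>[OF a b(3)] by (rule hom_mult[OF pr[OF a] b(1,3)])
    finally show "\<Phi> a (x \<otimes>\<^bsub>K'\<lparr>carrier := h ` carrier K\<rparr>\<^esub> y) = \<Phi> a x \<otimes>\<^bsub>L\<^esub> \<Phi> a y" .
  qed
  \<comment> \<open>The preimage of \<open>x\<close> picked by \<open>inv_into\<close> is the same
    for all \<open>a\<close>, so additivity in \<open>a\<close> is inherited from
    \<open>p\<close>.\<close>
  moreover have "(\<lambda>a. \<Phi> a x) \<in> hom (H\<lparr>carrier := S\<rparr>) L" if "x \<in> h ` carrier K" for x
  proof -
    have "inv_into (carrier K) h x \<in> carrier K" using that by (rule inv_into_into)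
    from pl[OF this] show ?thesis
      using S unfolding \<Phi>_def hom_def by (auto simp: Pi_iff subset_iff)
  qed
  ultimately have "bilinear_pairing (H\<lparr>carrier := S\<rparr>) (K'\<lparr>carrier := h ` carrier K\<rparr>) L \<Phi>"
    unfolding bilinear_pairing_def by simp
  then show ?thesis using \<Phi> by blast
qed

theorem theorem4p6:
  fixes G :: "'g tgroup"
    and A' :: "('g, 'a1) gmodule" and A :: "('g, 'a) gmodule" and A'' :: "('g, 'a2) gmodule"
    and B' :: "('g, 'b1) gmodule" and B :: "('g, 'b) gmodule" and B'' :: "('g, 'b2) gmodule"
    and C :: "('g, 'c) gmodule"
    and D :: "('g, 'd) gmodule" and D'' :: "('g, 'd2) gmodule" and E :: "('g, 'e) gmodule"
    and iA :: "'a1 \<Rightarrow> 'a" and jA :: "'a \<Rightarrow> 'a2" and iB :: "'b1 \<Rightarrow> 'b" and jB :: "'b \<Rightarrow> 'b2"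
    and p :: "'a1 \<Rightarrow> 'b \<Rightarrow> 'c" and q :: "'a \<Rightarrow> 'b1 \<Rightarrow> 'c"
    and \<iota> :: "'b \<Rightarrow> 'd" and \<pi> :: "'d \<Rightarrow> 'e" and \<delta> :: "'d \<Rightarrow> 'd2"
    and \<phi> :: "'b2 \<Rightarrow> 'd2" and \<psi> :: "'d2 \<Rightarrow> 'e"
    and r s :: nat
  assumes "profinite_group G"
    and "tate_product G A' iA A jA A'' B' iB B jB B'' C p q"
    and "short_exact G B \<iota> D \<pi> E"
    and "short_exact G B'' \<phi> D'' \<psi> E"
    and "\<delta> \<in> gmod_hom G D D''"
    and "\<delta> ` carrier D = carrier D''"
    and "\<forall>b\<in>carrier B. \<delta> (\<iota> b) = \<phi> (jB b)"
    and "\<forall>d\<in>carrier D. \<psi> (\<delta> d) = \<pi> d"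
    and "s \<ge> 1"
  shows "(\<forall>\<alpha>\<in>coh_map G A'' r jA ` carrier (cohomology G A r).
           \<forall>\<beta>\<in>kernel (cohomology G B'' s) (cohomology G D'' s) (coh_map G D'' s \<phi>).
             aug_cup G A' iA A jA B' iB B jB C p q r s \<alpha> \<beta> = \<one>\<^bsub>cohomology G C (r + s + 1)\<^esub>) \<and>
         (\<exists>\<Phi>. bilinear_pairing
                ((cohomology G A'' r)\<lparr>carrier := coh_map G A'' r jA ` carrier (cohomology G A r)\<rparr>)
                ((cohomology G D'' s)\<lparr>carrier := coh_map G D'' s \<phi> ` carrier (cohomology G B'' s)\<rparr>)
                (cohomology G C (r + s + 1)) \<Phi> \<and>
              (\<forall>\<alpha>\<in>coh_map G A'' r jA ` carrier (cohomology G A r). \<forall>\<beta>\<in>carrier (cohomology G B'' s).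
                 \<Phi> \<alpha> (coh_map G D'' s \<phi> \<beta>) = aug_cup G A' iA A jA B' iB B jB C p q r s \<alpha> \<beta>))"
proof -
  have jB: "jB \<in> gmod_hom G B B''"
    using assms(2) unfolding tate_product_def short_exact_def by blast
  interpret T: profinite_tate_product G A' iA A jA A'' B' iB B jB B'' C p q
    by (intro profinite_tate_product.intro assms(1,2))
  interpret b'': profinite_short_exact G B'' \<phi> D'' \<psi> E
    by (intro profinite_short_exact.intro profinite_short_exact_axioms.intro assms(1,4))
  let ?S = "coh_map G A'' r jA ` carrier (cohomology G A r)"
  have trivial: "aug_cup G A' iA A jA B' iB B jB C p q r s \<alpha> \<beta> = \<one>\<^bsub>cohomology G C (r + s + 1)\<^esub>"
    if \<alpha>: "\<alpha> \<in> ?S" and \<beta>: "\<beta> \<in> kernel (cohomology G B'' s) (cohomology G D'' s) (coh_map G D'' s \<phi>)" for \<alpha> \<beta>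
  proof -
    obtain f where f: "f \<in> carrier (cocycles G A r)" "\<alpha> = coh_map G A'' r jA (coh_class G A r f)"
      using \<alpha> unfolding T.a.B.carrier_cohomology by blast
    obtain g where g: "g \<in> carrier (cocycles G B s)" "\<beta> = coh_class G B'' s (cochain_map G s jB g)"
      using kernel_class_lifts_to_cocycle[OF assms(1,3,4) jB assms(5-9) \<beta>] .
    show ?thesis
      unfolding f(2) g(2) T.a.j.coh_map_coh_class[OF f(1)]
      by (rule T.aug_product_cocycles[OF f(1) g(1)])
  qed
  \<comment> \<open>Bilinearity on the full groups of A'' and B''; restricting to the image of
    \<open>jA\<close> and descending along \<open>\<phi>\<close> is left to
    \<open>bilinear_pairing_factors\<close>.\<close>
  have bilinear: "bilinear_pairing (cohomology G A'' r) (cohomology G B'' s) (cohomology G C (r + s + 1))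
      (aug_cup G A' iA A jA B' iB B jB C p q r s)"
    unfolding bilinear_pairing_def
    by (intro conjI ballI homI T.aug_product_closed T.aug_product_mult_left T.aug_product_mult_right)
  have S: "?S \<subseteq> carrier (cohomology G A'' r)"
    using hom_in_carrier[OF T.a.j.coh_map_hom] by blast
  show ?thesis
  proof (rule conjI)
    show "\<exists>\<Phi>. bilinear_pairing
        ((cohomology G A'' r)\<lparr>carrier := ?S\<rparr>)
        ((cohomology G D'' s)\<lparr>carrier := coh_map G D'' s \<phi> ` carrier (cohomology G B'' s)\<rparr>)
        (cohomology G C (r + s + 1)) \<Phi> \<and>
      (\<forall>\<alpha>\<in>?S. \<forall>\<beta>\<in>carrier (cohomology G B'' s).
        \<Phi> \<alpha> (coh_map G D'' s \<phi> \<beta>) = aug_cup G A' iA A jA B' iB B jB C p q r s \<alpha> \<beta>)"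
      by (rule bilinear_pairing_factors[OF bilinear b''.i.coh_map_hom T.b.C.cohomology.is_group
            b''.B.cohomology.is_group T.C.cohomology.is_group S trivial])
  qed (intro ballI trivial)
qed

end
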